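(* Let $r$ be a rank array that can occur. The double quiver polynomial of $r$ is $$\mathcal Q_r(\mathbf x-\mathring{\mathbf y})=\sum_{D\in\mathcal{RP}(v(r))}(\mathbf x-\mathring{\mathbf y})^{D\smallsetminus D_{\mathit{Hom}}},$$ the sum over all reduced pipe dreams $D$ for the Zelevinsky permutation $v(r)$ of the monomials made from the crosses of $D$ occupying the block antidiagonal and the block superantidiagonal (that is, ignoring the crosses occupying every box strictly above the block superantidiagonal).
   Context: Rank arrays. Let $k$ be a field, $n\ge1$, $r_0,\dots,r_n$ nonnegative integers, $d=r_0+\cdots+r_n$, $\mathit{Hom}=\prod_{i=1}^nM_{r_{i-1}\times r_i}(k)$. The rank array of $\phi\in\mathit{Hom}$ is $r_{ij}(\phi)=\operatorname{rank}(\phi_{i+1}\cdots\phi_j)$ for $i<j$, $r_{ii}(\phi)=r_i$. A rank array can occur if it is $r(\phi)$ for some $\phi\in\mathit{Hom}$. Zelevinsky permutation. Put $s_{ij}=r_{ij}-r_{i-1,j}-r_{i,j+1}+r_{i-1,j+1}$ for $0\le i\le j\le n$, where $r_{ab}=0$ unless $0\le a,b\le n$. Divide the $d\times d$ grid into block rows $0,\dots,n$ from top to bottom of heights $r_0,\dots,r_n$ and block columns labelled $n,\dots,0$ from left to right, block column $i$ having width $r_i$. The matrix of a permutation $v$ has its $1$'s at $(q,v(q))$. $v(r)\in S_d$ is the unique permutation such that the block in block column $i$ and block row $j$ contains exactly $s_{ij}$ ones if $i\le j$, $r_{j,j+1}$ ones if $i=j+1$, none if $i\ge j+2$, and such that within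 every block row and block column the $1$'s proceed from northwest to southeast. $v(\mathit{Hom})$ is $v(r')$ for $r'_{ij}=\min_{i\le k\le j}r_k$. The blocks with $i=j$ form the block antidiagonal, those with $i=j+1$ the block superantidiagonal; $D_{\mathit{Hom}}$ is the set of all boxes in blocks with $i\ge j+2$. Double Schubert polynomials and double quiver polynomials. For $w\in S_N$: $\mathfrak S_{w_0}(x-y)=\prod_{i+j\le N}(x_i-y_j)$ for the longest $w_0$, and $\mathfrak S_w=\partial_q\mathfrak S_{ws_q}$ if $w(q)<w(q+1)$, where $s_q=(q\ q{+}1)$ and $\partial_qP=(P-P|_{x_q\leftrightarrow x_{q+1}})/(x_q-x_{q+1})$. With $\mathbf x^j=(x^j_1,\dots,x^j_{r_j})$, $\mathbf y^j=(y^j_1,\dots,y^j_{r_j})$, the double quiver polynomial is $\mathcal Q_r(\mathbf x-\mathring{\mathbf y})=\mathfrak S_{v(r)}(\mathbf x-\mathring{\mathbf y})/\mathfrak S_{v(\mathit{Hom})}(\mathbf x-\mathring{\mathbf y})$, where the first $d$ variables are the concatenation $\mathbf x^0,\dots,\mathbf x^n$ and the second $d$ variables the concatenation $\mathbf y^n,\dots,\mathbf y^0$. Pipe dreams. A pipe dream $D$ is a subset of the boxes $(q,p)$ (row $q$, column $p$) of the $d\times d$ grid, all with $q+p\le d$. Boxes in $D$ carry a crossing tile and all others an elbow tile (the pipe entering from the west turns north, the pipe entering from the south turns east). $D$ is reduced if every two pipes cross at most once. $\mathcal{RP}(v)$ is the set of reduced pipe dreams in which the pipe entering row $q$ from the west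 exits at the top of column $v(q)$, for all $q\le d$. Label rows from top to bottom by $\mathbf x^0,\dots,\mathbf x^n$ and columns from left to right by $\mathbf y^n,\dots,\mathbf y^0$; for a set $E$ of boxes, $(\mathbf x-\mathring{\mathbf y})^E=\prod_{b\in E}(x_{\mathrm{row}(b)}-y_{\mathrm{col}(b)})$, using the labels of the row and column of $b$. *)

theory Defs
  imports
    "Jordan_Normal_Form.DL_Rank"
    "HOL-Library.Poly_Mapping"
    "HOL-Library.Countable"
    "HOL-Computational_Algebra.Fraction_Field"
    "HOL-Combinatorics.Permutations"
begin

section \<open>Rank arrays\<close>

text \<open>
  Throughout, \<open>n\<close> is the last block index and \<open>e i\<close> is the dimension
  \<open>r\<^sub>i\<close> for \<open>i \<le> n\<close>. A rank array is a function \<open>r\<close> of which only the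
  values \<open>r i j\<close> with \<open>i \<le> j \<le> n\<close> matter.
\<close>

definition quiver_Hom :: "nat \<Rightarrow> (nat \<Rightarrow> nat) \<Rightarrow> (nat \<Rightarrow> 'k::field mat) set" where
  "quiver_Hom n e = {\<phi>. \<forall>i\<in>{1..n}. \<phi> i \<in> carrier_mat (e (i - 1)) (e i)}"

definition map_chain :: "(nat \<Rightarrow> nat) \<Rightarrow> (nat \<Rightarrow> 'k::field mat) \<Rightarrow> nat \<Rightarrow> nat \<Rightarrow> 'k mat" where
  "map_chain e \<phi> i j = foldr (*) (map \<phi> [i + 1..<j + 1]) (1\<^sub>m (e j))"

definition rank_array_of :: "(nat \<Rightarrow> nat) \<Rightarrow> (nat \<Rightarrow> 'k::field mat) \<Rightarrow> nat \<Rightarrow> nat \<Rightarrow> nat" where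
  "rank_array_of e \<phi> i j = (if i = j then e i else vec_space.rank (e i) (map_chain e \<phi> i j))"

definition can_occur :: "'k::field itself \<Rightarrow> nat \<Rightarrow> (nat \<Rightarrow> nat) \<Rightarrow> (nat \<Rightarrow> nat \<Rightarrow> nat) \<Rightarrow> bool" where
  "can_occur _ n e r \<longleftrightarrow>
     (\<exists>\<phi>\<in>(quiver_Hom n e :: (nat \<Rightarrow> 'k mat) set).
        \<forall>i j. i \<le> j \<and> j \<le> n \<longrightarrow> r i j = rank_array_of e \<phi> i j)"

section \<open>The Zelevinsky permutation\<close>

definition total_dim :: "nat \<Rightarrow> (nat \<Rightarrow> nat) \<Rightarrow> nat" where
  "total_dim n e = (\<Sum>i\<le>n. e i)"

text \<open>The index arithmetic is done in \<^typ>\<open>int\<close> because \<open>i - 1\<close> may be \<open>-1\<close>.\<close>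

definition ext_rank :: "nat \<Rightarrow> (nat \<Rightarrow> nat \<Rightarrow> nat) \<Rightarrow> int \<Rightarrow> int \<Rightarrow> int" where
  "ext_rank n r a b =
     (if 0 \<le> a \<and> a \<le> int n \<and> 0 \<le> b \<and> b \<le> int n then int (r (nat a) (nat b)) else 0)"

definition lace :: "nat \<Rightarrow> (nat \<Rightarrow> nat \<Rightarrow> nat) \<Rightarrow> nat \<Rightarrow> nat \<Rightarrow> int" where
  "lace n r i j =
     ext_rank n r (int i) (int j) - ext_rank n r (int i - 1) (int j)
     - ext_rank n r (int i) (int j + 1) + ext_rank n r (int i - 1) (int j + 1)"

definition block_row :: "(nat \<Rightarrow> nat) \<Rightarrow> nat \<Rightarrow> nat set" where
  "block_row e j = {(\<Sum>l<j. e l)<..(\<Sum>l<j. e l) + e j}"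

text \<open>Block columns are labelled \<open>n, \<dots>, 0\<close> from left to right.\<close>

definition block_col :: "nat \<Rightarrow> (nat \<Rightarrow> nat) \<Rightarrow> nat \<Rightarrow> nat set" where
  "block_col n e i = {(\<Sum>l\<in>{i<..n}. e l)<..(\<Sum>l\<in>{i<..n}. e l) + e i}"

definition ones_in_block :: "nat \<Rightarrow> (nat \<Rightarrow> nat) \<Rightarrow> (nat \<Rightarrow> nat) \<Rightarrow> nat \<Rightarrow> nat \<Rightarrow> nat" where
  "ones_in_block n e v i j = card {q \<in> block_row e j. v q \<in> block_col n e i}"

definition is_zelevinsky ::
  "nat \<Rightarrow> (nat \<Rightarrow> nat) \<Rightarrow> (nat \<Rightarrow> nat \<Rightarrow> nat) \<Rightarrow> (nat \<Rightarrow> nat) \<Rightarrow> bool" where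
  "is_zelevinsky n e r v \<longleftrightarrow>
     v permutes {1..total_dim n e} \<and>
     (\<forall>i\<le>n. \<forall>j\<le>n.
        (i \<le> j \<longrightarrow> int (ones_in_block n e v i j) = lace n r i j) \<and>
        (i = j + 1 \<longrightarrow> ones_in_block n e v i j = r j (j + 1)) \<and>
        (i \<ge> j + 2 \<longrightarrow> ones_in_block n e v i j = 0)) \<and>
     (\<forall>j\<le>n. \<forall>q\<in>block_row e j. \<forall>q'\<in>block_row e j. q < q' \<longrightarrow> v q < v q') \<and>
     (\<forall>i\<le>n. \<forall>q q'. v q \<in> block_col n e i \<and> v q' \<in> block_col n e i \<and> v q < v q' \<longrightarrow> q < q')"

definition zelevinsky :: "nat \<Rightarrow> (nat \<Rightarrow> nat) \<Rightarrow> (nat \<Rightarrow> nat \<Rightarrow> nat) \<Rightarrow> nat \<Rightarrow> nat" where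
  "zelevinsky n e r = (THE v. is_zelevinsky n e r v)"

definition zelevinsky_Hom :: "nat \<Rightarrow> (nat \<Rightarrow> nat) \<Rightarrow> nat \<Rightarrow> nat" where
  "zelevinsky_Hom n e = zelevinsky n e (\<lambda>i j. Min (e ` {i..j}))"

definition D_Hom :: "nat \<Rightarrow> (nat \<Rightarrow> nat) \<Rightarrow> (nat \<times> nat) set" where
  "D_Hom n e = {(q, p). \<exists>i\<le>n. \<exists>j\<le>n. i \<ge> j + 2 \<and> q \<in> block_row e j \<and> p \<in> block_col n e i}"

section \<open>Polynomials in two alphabets\<close>

text \<open>
  Variables \<open>x\<^sub>a\<close> and \<open>y\<^sub>a\<close> with \<open>a\<close> from an arbitrary countable index type:
  positions for Schubert polynomials, pairs \<open>(j, i)\<close> for the variables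
  \<open>x\<^sup>j\<^sub>i\<close> and \<open>y\<^sup>j\<^sub>i\<close> of quiver polynomials.
\<close>

datatype 'a var = X 'a | Y 'a

instance var :: (countable) countable
  by countable_datatype

text \<open>
  The order on variables carries no meaning; the library's integral domain instance
  for \<^type>\<open>poly_mapping\<close> asks for one.
\<close>

instantiation var :: (countable) linorder
begin

definition less_eq_var :: "'a var \<Rightarrow> 'a var \<Rightarrow> bool" where
  "less_eq_var u v \<longleftrightarrow> to_nat u \<le> to_nat v"

definition less_var :: "'a var \<Rightarrow> 'a var \<Rightarrow> bool" where
  "less_var u v \<longleftrightarrow> to_nat u < to_nat v"

instance
  by standard (auto simp: less_eq_var_def less_var_def)

end

type_synonym 'a xypoly = "('a var \<Rightarrow>\<^sub>0 nat) \<Rightarrow>\<^sub>0 int"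

definition Var :: "'a var \<Rightarrow> 'a xypoly" where
  "Var v = Poly_Mapping.single (Poly_Mapping.single v 1) 1"

definition poly_subst :: "('a var \<Rightarrow> 'b xypoly) \<Rightarrow> 'a xypoly \<Rightarrow> 'b xypoly" where
  "poly_subst \<sigma> P =
     (\<Sum>m\<in>Poly_Mapping.keys P.
        of_int (Poly_Mapping.lookup P m) *
        (\<Prod>v\<in>Poly_Mapping.keys m. \<sigma> v ^ Poly_Mapping.lookup m v))"

section \<open>Double Schubert polynomials\<close>

definition swap_x :: "nat \<Rightarrow> nat xypoly \<Rightarrow> nat xypoly" where
  "swap_x q = poly_subst (\<lambda>v. Var (Transposition.transpose (X q) (X (q + 1)) v))"

definition divided_difference :: "nat \<Rightarrow> nat xypoly \<Rightarrow> nat xypoly" where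
  "divided_difference q P =
     (THE Q. (Var (X q) - Var (X (q + 1))) * Q = P - swap_x q P)"

definition longest_perm :: "nat \<Rightarrow> nat \<Rightarrow> nat" where
  "longest_perm N q = (if q \<in> {1..N} then N + 1 - q else q)"

text \<open>
  The recursion for double Schubert polynomials may use any ascent \<open>q\<close> of \<open>w\<close>. It is
  stated as a relation so that no particular ascent is preferred.
\<close>

inductive is_double_schubert :: "nat \<Rightarrow> (nat \<Rightarrow> nat) \<Rightarrow> nat xypoly \<Rightarrow> bool" for N :: nat where
  longest: "is_double_schubert N (longest_perm N)
     (\<Prod>(i, j)\<in>{(i, j). 1 \<le> i \<and> 1 \<le> j \<and> i + j \<le> N}. (Var (X i) - Var (Y j)))"
| ascent: "w permutes {1..N} \<Longrightarrow> 1 \<le> q \<Longrightarrow> q < N \<Longrightarrow> w q < w (q + 1) \<Longrightarrow>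
     is_double_schubert N (w \<circ> Transposition.transpose q (q + 1)) P \<Longrightarrow>
     is_double_schubert N w (divided_difference q P)"

definition double_schubert :: "nat \<Rightarrow> (nat \<Rightarrow> nat) \<Rightarrow> nat xypoly" where
  "double_schubert N w = (THE P. is_double_schubert N w P)"

section \<open>Double quiver polynomials\<close>

definition row_labels :: "nat \<Rightarrow> (nat \<Rightarrow> nat) \<Rightarrow> (nat \<times> nat) var list" where
  "row_labels n e = concat (map (\<lambda>j. map (\<lambda>i. X (j, i)) [1..<e j + 1]) [0..<n + 1])"

definition col_labels :: "nat \<Rightarrow> (nat \<Rightarrow> nat) \<Rightarrow> (nat \<times> nat) var list" where
  "col_labels n e = concat (map (\<lambda>j. map (\<lambda>i. Y (j, i)) [1..<e j + 1]) (rev [0..<n + 1]))"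

text \<open>Rows and columns are numbered from 1.\<close>

definition row_var :: "nat \<Rightarrow> (nat \<Rightarrow> nat) \<Rightarrow> nat \<Rightarrow> (nat \<times> nat) xypoly" where
  "row_var n e q = Var (row_labels n e ! (q - 1))"

definition col_var :: "nat \<Rightarrow> (nat \<Rightarrow> nat) \<Rightarrow> nat \<Rightarrow> (nat \<times> nat) xypoly" where
  "col_var n e p = Var (col_labels n e ! (p - 1))"

definition quiver_schubert :: "nat \<Rightarrow> (nat \<Rightarrow> nat) \<Rightarrow> (nat \<Rightarrow> nat) \<Rightarrow> (nat \<times> nat) xypoly" where
  "quiver_schubert n e w =
     poly_subst (case_var (row_var n e) (col_var n e)) (double_schubert (total_dim n e) w)"

text \<open>The quotient is taken in the field of fractions.\<close>

definition double_quiver_poly ::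
  "nat \<Rightarrow> (nat \<Rightarrow> nat) \<Rightarrow> (nat \<Rightarrow> nat \<Rightarrow> nat) \<Rightarrow> (nat \<times> nat) xypoly fract" where
  "double_quiver_poly n e r =
     Fraction_Field.Fract (quiver_schubert n e (zelevinsky n e r)) 1 /
     Fraction_Field.Fract (quiver_schubert n e (zelevinsky_Hom n e)) 1"

section \<open>Pipe dreams\<close>

datatype side = West | South

text \<open>
  \<open>pipe D a (q, p) s\<close>: the pipe that enters row \<open>a\<close> from the west enters box \<open>(q, p)\<close>
  through its side \<open>s\<close>. Leaving row 1 through the top of column \<open>p\<close> is recorded as
  entering the fictitious box \<open>(0, p)\<close> from the south, where the pipe stops.
\<close>

inductive pipe :: "(nat \<times> nat) set \<Rightarrow> nat \<Rightarrow> nat \<times> nat \<Rightarrow> side \<Rightarrow> bool"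
  for D :: "(nat \<times> nat) set" and a :: nat where
  start: "pipe D a (a, 1) West"
| cross_west: "pipe D a (q, p) West \<Longrightarrow> 1 \<le> q \<Longrightarrow> (q, p) \<in> D \<Longrightarrow> pipe D a (q, p + 1) West"
| cross_south: "pipe D a (q, p) South \<Longrightarrow> 1 \<le> q \<Longrightarrow> (q, p) \<in> D \<Longrightarrow> pipe D a (q - 1, p) South"
| elbow_west: "pipe D a (q, p) West \<Longrightarrow> 1 \<le> q \<Longrightarrow> (q, p) \<notin> D \<Longrightarrow> pipe D a (q - 1, p) South"
| elbow_south: "pipe D a (q, p) South \<Longrightarrow> 1 \<le> q \<Longrightarrow> (q, p) \<notin> D \<Longrightarrow> pipe D a (q, p + 1) West"

definition exits_at :: "(nat \<times> nat) set \<Rightarrow> nat \<Rightarrow> nat \<Rightarrow> bool" where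
  "exits_at D a p \<longleftrightarrow> pipe D a (0, p) South"

definition crossings :: "(nat \<times> nat) set \<Rightarrow> nat \<Rightarrow> nat \<Rightarrow> (nat \<times> nat) set" where
  "crossings D a b =
     {c \<in> D. pipe D a c West \<and> pipe D b c South \<or> pipe D a c South \<and> pipe D b c West}"

definition pipe_dream :: "nat \<Rightarrow> (nat \<times> nat) set \<Rightarrow> bool" where
  "pipe_dream d D \<longleftrightarrow> D \<subseteq> {(q, p). 1 \<le> q \<and> 1 \<le> p \<and> q + p \<le> d}"

definition reduced_pipe_dream :: "nat \<Rightarrow> (nat \<times> nat) set \<Rightarrow> bool" where
  "reduced_pipe_dream d D \<longleftrightarrow>
     pipe_dream d D \<and> (\<forall>a\<in>{1..d}. \<forall>b\<in>{1..d}. a \<noteq> b \<longrightarrow> card (crossings D a b) \<le> 1)"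

definition RP :: "nat \<Rightarrow> (nat \<Rightarrow> nat) \<Rightarrow> (nat \<times> nat) set set" where
  "RP d v = {D. reduced_pipe_dream d D \<and> (\<forall>q\<in>{1..d}. exits_at D q (v q))}"

definition box_monomial :: "nat \<Rightarrow> (nat \<Rightarrow> nat) \<Rightarrow> (nat \<times> nat) set \<Rightarrow> (nat \<times> nat) xypoly" where
  "box_monomial n e E = (\<Prod>(q, p)\<in>E. (row_var n e q - col_var n e p))"

end

theory Submission
  imports Defs
begin

text \<open>
  Multiplying out the nilCoxeter product of the factors \<open>1 + (x\<^sub>q - y\<^sub>p) u\<^sub>q\<^sub>+\<^sub>p\<^sub>-\<^sub>1\<close>, rows from top to
  bottom and columns from right to left, gives the generating function of reduced pipe dreams.
  By the Yang-Baxter equation, multiplying it by \<open>1 + (x\<^sub>q\<^sub>+\<^sub>1 - x\<^sub>q) u\<^sub>q\<close> exchanges \<open>x\<^sub>q\<close> and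
  \<open>x\<^sub>q\<^sub>+\<^sub>1\<close>; this is the divided difference recursion (Fomin and Kirillov), so double Schubert
  polynomials are sums over reduced pipe dreams. If the matrix of \<open>v\<close> has no ones in a Young
  shape, then every pipe dream for \<open>v\<close> has crosses on the whole shape, since the northwesternmost
  elbow would send a pipe straight to a forbidden exit. Hence \<open>D\<^sub>H\<^sub>o\<^sub>m\<close> is contained in every pipe
  dream for \<open>v(r)\<close>, while for \<open>v(Hom)\<close>, all of whose inversions come from \<open>D\<^sub>H\<^sub>o\<^sub>m\<close>, it is the
  only reduced pipe dream. Dividing by its monomial leaves the crosses outside \<open>D\<^sub>H\<^sub>o\<^sub>m\<close>.

  The permutation \<open>v(r)\<close> exists because the lace numbers \<open>s\<^sub>i\<^sub>j\<close> of an occurring rank array are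
  nonnegative, by the Frobenius rank inequality.
\<close>

section \<open>The nilCoxeter algebra\<close>

text \<open>The definition of \<open>pipe\<close> follows a pipe from its entrance, whereas the
  product over the staircase begins in row 1, where pipes leave. Pipes are therefore labelled by
  their exit columns: reading the box (q, p) transposes the labels at positions q+p-1 and q+p if the
  box carries a cross and keeps them otherwise. Crossings of two pipes become exchanges of two
  labels, and a parity argument identifies "at most one exchange" with "every exchange increases the
  length". No pipe dream is ever constructed for existence. That one exists follows from the
  nonvanishing of the sum over all of them; with the two inclusions for a Young shape this settles
  both v(Hom) and the longest permutation, the base of the Schubert recursion. Since every
  derivation of a Schubert polynomial ends in the same sum, independence of the chosen ascents is a
  by-product. Zelevinsky permutations are treated as a case of a general fact: a table of
  nonnegative integers with row and column sums \<open>e\<close> determines exactly one permutation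
  that is sorted in all blocks. Lace numbers and superantidiagonal ranks form such a table because
  the former telescope.\<close>

text \<open>
  Functions of \<open>w\<close> stand for elements of the nilCoxeter algebra; \<open>nil_factor i t\<close> is right
  multiplication by \<open>1 + t u\<^sub>i\<close>.
\<close>

definition nil_factor ::
  "nat \<Rightarrow> 'r \<Rightarrow> ((nat \<Rightarrow> nat) \<Rightarrow> 'r) \<Rightarrow> (nat \<Rightarrow> nat) \<Rightarrow> 'r::comm_ring_1" where
  "nil_factor i t f w =
     f w + (if w (Suc i) < w i then t * f (w \<circ> transpose i (Suc i)) else 0)"

text \<open>This is u_i^2 = 0: where \<open>w\<close> has a descent at \<open>i\<close>,
  \<open>w \<circ> transpose i (Suc i)\<close> has an ascent, so no term of second order
  survives.\<close>

lemma nil_factor_add: "nil_factor i s (nil_factor i t f) = nil_factor i (s + t) f"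
  by (rule ext) (simp add: nil_factor_def comp_assoc algebra_simps)

lemma transpose_comp_commute:
  assumes "Suc i < j"
  shows "transpose i (Suc i) \<circ> transpose j (Suc j) = transpose j (Suc j) \<circ> transpose i (Suc i)"
  using assms by (auto simp: fun_eq_iff transpose_def)

lemma nil_factor_commute:
  assumes "Suc i < j"
  shows "nil_factor i s (nil_factor j t f) = nil_factor j t (nil_factor i s f)"
proof (rule ext)
  fix w :: "nat \<Rightarrow> nat"
  have eq: "w \<circ> transpose j (Suc j) \<circ> transpose i (Suc i) = w \<circ> transpose i (Suc i) \<circ> transpose j (Suc j)"
    using transpose_comp_commute[OF assms] by (simp add: comp_assoc)
  then show "nil_factor i s (nil_factor j t f) w = nil_factor j t (nil_factor i s f) w"
    using assms unfolding nil_factor_def eq by (simp add: transpose_def algebra_simps)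
qed

lemma transpose_braid:
  "transpose i (Suc i) \<circ> transpose (Suc i) (Suc (Suc i)) \<circ> transpose i (Suc i) =
   transpose (Suc i) (Suc (Suc i)) \<circ> transpose i (Suc i) \<circ> transpose (Suc i) (Suc (Suc i))"
  by (auto simp: fun_eq_iff transpose_def)

text \<open>Additive Yang-Baxter equation: the middle parameter is the sum of the outer ones. The
  order of the three values of \<open>w\<close> at \<open>i\<close>, \<open>i+1\<close>,
  \<open>i+2\<close> decides which terms occur, and the braid relation matches the terms of third
  order.\<close>

lemma nil_factor_Yang_Baxter:
  "nil_factor i t (nil_factor (Suc i) (s + t) (nil_factor i s f)) =
   nil_factor (Suc i) s (nil_factor i (s + t) (nil_factor (Suc i) t f))"
proof (rule ext)
  fix w :: "nat \<Rightarrow> nat"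
  let ?\<sigma> = "transpose i (Suc i)" and ?\<tau> = "transpose (Suc i) (Suc (Suc i))"
  have braid: "w \<circ> ?\<sigma> \<circ> ?\<tau> \<circ> ?\<sigma> = w \<circ> ?\<tau> \<circ> ?\<sigma> \<circ> ?\<tau>"
    using transpose_braid[of i] by (metis comp_assoc)
  have invol: "v \<circ> transpose k l \<circ> transpose k l = v" for v :: "nat \<Rightarrow> nat" and k l
    by (simp add: comp_assoc)
  have vals: "?\<sigma> i = Suc i" "?\<sigma> (Suc i) = i" "?\<sigma> (Suc (Suc i)) = Suc (Suc i)"
    "?\<tau> i = i" "?\<tau> (Suc i) = Suc (Suc i)" "?\<tau> (Suc (Suc i)) = Suc i"
    by (simp_all add: transpose_def)
  show "nil_factor i t (nil_factor (Suc i) (s + t) (nil_factor i s f)) w =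
    nil_factor (Suc i) s (nil_factor i (s + t) (nil_factor (Suc i) t f)) w"
    unfolding nil_factor_def invol comp_apply vals braid
    by (auto simp: algebra_simps)
qed

section \<open>Products over the boxes of the staircase\<close>

definition word_op ::
  "(nat \<times> nat \<Rightarrow> 'r) \<Rightarrow> (nat \<times> nat) list \<Rightarrow> ((nat \<Rightarrow> nat) \<Rightarrow> 'r) \<Rightarrow> (nat \<Rightarrow> nat) \<Rightarrow> 'r::comm_ring_1"
  where
  "word_op t = fold (\<lambda>(q, p). nil_factor (q + p - 1) (t (q, p)))"

primrec row_boxes :: "nat \<Rightarrow> nat \<Rightarrow> (nat \<times> nat) list" where
  "row_boxes q 0 = []"
| "row_boxes q (Suc k) = (q, Suc k) # row_boxes q k"

primrec stair_boxes :: "nat \<Rightarrow> nat \<Rightarrow> (nat \<times> nat) list" where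
  "stair_boxes N 0 = []"
| "stair_boxes N (Suc m) = stair_boxes N m @ row_boxes (Suc m) (N - Suc m)"

definition schubert_gen :: "nat \<Rightarrow> (nat \<times> nat \<Rightarrow> 'r) \<Rightarrow> (nat \<Rightarrow> nat) \<Rightarrow> 'r::comm_ring_1" where
  "schubert_gen N t = word_op t (stair_boxes N N) (\<lambda>w. if w = id then 1 else 0)"

lemma word_op_Nil [simp]: "word_op t [] f = f"
  by (simp add: word_op_def)

lemma word_op_append [simp]: "word_op t (L @ M) f = word_op t M (word_op t L f)"
  by (simp add: word_op_def)

lemma word_op_row_Suc [simp]:
  "word_op t (row_boxes q (Suc k)) f = word_op t (row_boxes q k) (nil_factor (q + k) (t (q, Suc k)) f)"
  by (simp add: word_op_def)

lemma set_row_boxes: "set (row_boxes q k) = {q} \<times> {1..k}"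
  by (induction k) (simp_all add: atLeastAtMostSuc_conv)

lemma set_stair_boxes: "set (stair_boxes N m) = {(q, p). 1 \<le> q \<and> q \<le> m \<and> 1 \<le> p \<and> q + p \<le> N}"
proof (induction m)
  case (Suc m)
  have "b \<in> set (stair_boxes N (Suc m)) \<longleftrightarrow>
    b \<in> {(q, p). 1 \<le> q \<and> q \<le> Suc m \<and> 1 \<le> p \<and> q + p \<le> N}" for b
    by (cases b) (simp add: Suc.IH set_row_boxes, linarith)
  then show ?case by blast
qed simp

lemma distinct_row_boxes: "distinct (row_boxes q k)"
  by (induction k) (auto simp: set_row_boxes)

lemma distinct_stair_boxes: "distinct (stair_boxes N m)"
  by (induction m) (auto simp: distinct_row_boxes set_row_boxes set_stair_boxes)

lemma word_op_cong:
  "(\<And>b. b \<in> set L \<Longrightarrow> s b = t b) \<Longrightarrow> word_op s L f = word_op t L f"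
  by (induction L arbitrary: f) (auto simp: word_op_def)

text \<open>The row uses the positions q, ..., q+k-1, all of which are at distance at least 2 from
  \<open>j\<close>.\<close>

lemma nil_factor_row_above:
  "q + k < j \<Longrightarrow> nil_factor j s (word_op t (row_boxes q k) f) = word_op t (row_boxes q k) (nil_factor j s f)"
proof (induction k arbitrary: f)
  case (Suc k)
  then have "q + k < j" "Suc (q + k) < j" by simp_all
  then show ?case
    by (simp only: word_op_row_Suc Suc.IH) (subst nil_factor_commute, simp_all)
qed simp

lemma nil_factor_row_below:
  "Suc j < q \<Longrightarrow> nil_factor j s (word_op t (row_boxes q k) f) = word_op t (row_boxes q k) (nil_factor j s f)"
proof (induction k arbitrary: f)
  case (Suc k)
  then have "Suc j < q + k" by simp
  with Suc.prems show ?case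
    by (simp only: word_op_row_Suc Suc.IH) (subst nil_factor_commute, simp_all)
qed simp

text \<open>The factor with parameter \<open>b - a\<close> travels through both rows one column at a
  time. In each column the Yang-Baxter equation exchanges \<open>a\<close> and \<open>b\<close> and
  lets the factor reappear one position higher, so it enters at position \<open>q\<close> and
  emerges at \<open>q + k\<close>.\<close>

lemma nil_factor_two_rows:
  assumes "\<And>p. 1 \<le> p \<Longrightarrow> t (q, p) = a - y p" "\<And>p. 1 \<le> p \<Longrightarrow> t (Suc q, p) = b - y p"
    and "\<And>p. 1 \<le> p \<Longrightarrow> t' (q, p) = b - y p" "\<And>p. 1 \<le> p \<Longrightarrow> t' (Suc q, p) = a - y p"
  shows "nil_factor q (b - a) (word_op t (row_boxes (Suc q) k) (word_op t (row_boxes q k) f)) =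
    word_op t' (row_boxes (Suc q) k) (word_op t' (row_boxes q k) (nil_factor (q + k) (b - a) f))"
proof (induction k arbitrary: f)
  case 0
  show ?case by simp
next
  case (Suc k)
  note [simp del] = row_boxes.simps(2)
  let ?y = "y (Suc k)"
  have "nil_factor q (b - a) (word_op t (row_boxes (Suc q) (Suc k)) (word_op t (row_boxes q (Suc k)) f)) =
    nil_factor q (b - a) (word_op t (row_boxes (Suc q) k) (word_op t (row_boxes q k)
      (nil_factor (Suc (q + k)) (b - ?y) (nil_factor (q + k) (a - ?y) f))))"
    by (simp add: nil_factor_row_above assms)
  also have "\<dots> = word_op t' (row_boxes (Suc q) k) (word_op t' (row_boxes q k)
      (nil_factor (q + k) (b - a)
        (nil_factor (Suc (q + k)) ((a - ?y) + (b - a)) (nil_factor (q + k) (a - ?y) f))))"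
    by (simp add: Suc.IH)
  also have "\<dots> = word_op t' (row_boxes (Suc q) k) (word_op t' (row_boxes q k)
      (nil_factor (Suc (q + k)) (a - ?y)
        (nil_factor (q + k) (b - ?y) (nil_factor (Suc (q + k)) (b - a) f))))"
    by (subst nil_factor_Yang_Baxter) simp
  also have "\<dots> = word_op t' (row_boxes (Suc q) (Suc k)) (word_op t' (row_boxes q (Suc k))
      (nil_factor (q + Suc k) (b - a) f))"
    by (simp add: nil_factor_row_above assms)
  finally show ?case .
qed

text \<open>Rows below \<open>q + 1\<close> use positions that commute with \<open>q\<close>, so the
  factor reaches the rows \<open>q\<close> and \<open>q + 1\<close>; the rows above contain neither
  of the two exchanged variables.\<close>

lemma nil_factor_stair:
  fixes x y :: "nat \<Rightarrow> 'r::comm_ring_1"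
  assumes "1 \<le> q" "q < N" "q < m"
  shows "nil_factor q (x (Suc q) - x q) (word_op (\<lambda>(i, j). x i - y j) (stair_boxes N m) f) =
    word_op (\<lambda>(i, j). x (transpose q (Suc q) i) - y j) (stair_boxes N m) f"
    (is "nil_factor q _ (word_op ?t _ _) = word_op ?t' _ _")
  using \<open>q < m\<close>
proof (induction m)
  case 0
  then show ?case by simp
next
  case (Suc m)
  have same: "word_op ?t (row_boxes i k) g = word_op ?t' (row_boxes i k) g"
    if "i \<noteq> q" "i \<noteq> Suc q" for i k g
    using that by (intro word_op_cong) (auto simp: set_row_boxes transpose_def)
  show ?case
  proof (cases "q = m")
    case True
    obtain m' where m': "m = Suc m'"
      using True \<open>1 \<le> q\<close> by (cases m) auto
    \<comment> \<open>Row \<open>q\<close> has exactly one box more than row \<open>q + 1\<close>.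
      It stands at position \<open>q + k\<close>, where the travelling factor arrives, and absorbs
      it: the parameters add up to x_{q+1} - y_{k+1}.\<close>
    obtain k where k: "N - q = Suc k" "N - Suc q = k"
      using \<open>q < N\<close> by (metis Suc_diff_Suc)
    define g where "g = word_op ?t (stair_boxes N m') f"
    have g': "g = word_op ?t' (stair_boxes N m') f"
      unfolding g_def using m' True
      by (intro word_op_cong) (auto simp: set_stair_boxes transpose_def)
    have "nil_factor q (x (Suc q) - x q) (word_op ?t (stair_boxes N (Suc m)) f) =
      nil_factor q (x (Suc q) - x q)
        (word_op ?t (row_boxes (Suc q) k) (word_op ?t (row_boxes q k)
          (nil_factor (q + k) (x q - y (Suc k)) g)))"
      using k True m' by (simp add: g_def del: row_boxes.simps)
    also have "\<dots> = word_op ?t' (row_boxes (Suc q) k) (word_op ?t' (row_boxes q k)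
        (nil_factor (q + k) (x (Suc q) - x q) (nil_factor (q + k) (x q - y (Suc k)) g)))"
      by (rule nil_factor_two_rows[where y = y]) auto
    also have "\<dots> = word_op ?t' (stair_boxes N (Suc m)) f"
      using k True m' by (simp add: g' nil_factor_add del: row_boxes.simps)
    finally show ?thesis .
  next
    case False
    then have "q < m" using Suc.prems by simp
    then show ?thesis
      using Suc.IH same[of "Suc m"] by (simp add: nil_factor_row_below)
  qed
qed

lemma schubert_gen_transpose:
  fixes x y :: "nat \<Rightarrow> 'r::comm_ring_1"
  assumes "1 \<le> q" "q < N"
  shows "nil_factor q (x (Suc q) - x q) (schubert_gen N (\<lambda>(i, j). x i - y j)) =
    schubert_gen N (\<lambda>(i, j). x (transpose q (Suc q) i) - y j)"
  unfolding schubert_gen_def using assms by (intro nil_factor_stair) auto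

text \<open>The identity has no descent, so every factor leaves its coefficient unchanged.\<close>

lemma schubert_gen_id: "schubert_gen N t id = 1"
proof -
  have "word_op t L f id = f id" for L :: "(nat \<times> nat) list" and f :: "(nat \<Rightarrow> nat) \<Rightarrow> 'a"
    by (induction L arbitrary: f) (auto simp: word_op_def nil_factor_def)
  then show ?thesis by (simp add: schubert_gen_def)
qed

section \<open>Subwords\<close>

definition box_pos :: "nat \<times> nat \<Rightarrow> nat" where
  "box_pos b = fst b + snd b - 1"

definition word_perm :: "(nat \<times> nat) set \<Rightarrow> (nat \<times> nat) list \<Rightarrow> nat \<Rightarrow> nat" where
  "word_perm D L =
     fold (\<lambda>b \<pi>. if b \<in> D then \<pi> \<circ> transpose (box_pos b) (Suc (box_pos b)) else \<pi>) L id"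

text \<open>Reducedness is expressed by an ascent before each chosen box instead of by lengths,
  because this is the condition under which \<open>nil_factor\<close> contributes a term.\<close>

definition reduced_word :: "(nat \<times> nat) set \<Rightarrow> (nat \<times> nat) list \<Rightarrow> bool" where
  "reduced_word D L \<longleftrightarrow>
     (\<forall>L1 b L2. L = L1 @ b # L2 \<and> b \<in> D \<longrightarrow>
        word_perm D L1 (box_pos b) < word_perm D L1 (Suc (box_pos b)))"

text \<open>When labels are exit columns, these will be the boxes where the pipes leaving through
  columns \<open>x\<close> and \<open>y\<close> cross.\<close>

definition swaps ::
  "(nat \<times> nat) set \<Rightarrow> (nat \<times> nat) list \<Rightarrow> nat \<Rightarrow> nat \<Rightarrow> (nat \<times> nat) set" where
  "swaps D L x y =
     {b \<in> D. \<exists>L1 L2. L = L1 @ b # L2 \<and>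
        {word_perm D L1 (box_pos b), word_perm D L1 (Suc (box_pos b))} = {x, y}}"

lemma word_perm_Nil [simp]: "word_perm D [] = id"
  by (simp add: word_perm_def)

lemma word_perm_snoc [simp]:
  "word_perm D (L @ [b]) =
     (if b \<in> D then word_perm D L \<circ> transpose (box_pos b) (Suc (box_pos b)) else word_perm D L)"
  by (simp add: word_perm_def)

lemma word_perm_cong: "D \<inter> set L = E \<inter> set L \<Longrightarrow> word_perm D L = word_perm E L"
proof (induction L rule: rev_induct)
  case (snoc b L)
  then have "b \<in> D \<longleftrightarrow> b \<in> E" "D \<inter> set L = E \<inter> set L" by auto
  then show ?case by (simp only: word_perm_snoc snoc.IH)
qed simp

lemma snoc_eq_append_Cons:
  "L @ [b] = L1 @ c # L2 \<longleftrightarrow> L2 = [] \<and> L1 = L \<and> c = b \<or> (\<exists>L2'. L2 = L2' @ [b] \<and> L = L1 @ c # L2')"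
proof (cases L2 rule: rev_cases)
  case Nil
  then show ?thesis by auto
next
  case (snoc M y)
  then have "L @ [b] = L1 @ c # L2 \<longleftrightarrow> L @ [b] = (L1 @ c # M) @ [y]" by simp
  also have "\<dots> \<longleftrightarrow> L = L1 @ c # M \<and> b = y" by (rule append1_eq_conv)
  finally show ?thesis using snoc by auto
qed

lemma reduced_word_Nil [simp]: "reduced_word D []"
  by (simp add: reduced_word_def)

lemma reduced_word_snoc [simp]:
  "reduced_word D (L @ [b]) \<longleftrightarrow> reduced_word D L \<and>
     (b \<in> D \<longrightarrow> word_perm D L (box_pos b) < word_perm D L (Suc (box_pos b)))"
  unfolding reduced_word_def snoc_eq_append_Cons by blast

lemma reduced_word_cong:
  "D \<inter> set L = E \<inter> set L \<Longrightarrow> reduced_word D L = reduced_word E L"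
proof (induction L rule: rev_induct)
  case (snoc b L)
  then have "b \<in> D \<longleftrightarrow> b \<in> E" "D \<inter> set L = E \<inter> set L" by auto
  moreover from this(2) have "word_perm D L = word_perm E L" by (rule word_perm_cong)
  ultimately show ?case by (simp only: reduced_word_snoc snoc.IH)
qed simp

lemma swaps_Nil [simp]: "swaps D [] x y = {}"
  by (simp add: swaps_def)

lemma swaps_snoc:
  "swaps D (L @ [b]) x y = swaps D L x y \<union>
     (if b \<in> D \<and> {word_perm D L (box_pos b), word_perm D L (Suc (box_pos b))} = {x, y}
      then {b} else {})"
proof (rule Set.set_eqI)
  fix c
  have "c \<in> swaps D (L @ [b]) x y \<longleftrightarrow> c \<in> swaps D L x y \<or>
    c = b \<and> b \<in> D \<and> {word_perm D L (box_pos b), word_perm D L (Suc (box_pos b))} = {x, y}"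
    unfolding swaps_def mem_Collect_eq snoc_eq_append_Cons by blast
  then show "c \<in> swaps D (L @ [b]) x y \<longleftrightarrow> c \<in> swaps D L x y \<union>
     (if b \<in> D \<and> {word_perm D L (box_pos b), word_perm D L (Suc (box_pos b))} = {x, y}
      then {b} else {})"
    by (cases "b \<in> D \<and> {word_perm D L (box_pos b), word_perm D L (Suc (box_pos b))} = {x, y}") auto
qed

lemma swaps_subset: "swaps D L x y \<subseteq> set L"
  by (auto simp: swaps_def)

lemma bij_word_perm: "bij (word_perm D L)"
proof (induction L rule: rev_induct)
  case Nil
  show ?case unfolding word_perm_Nil by (rule bij_id)
next
  case (snoc b L)
  then show ?case
    unfolding word_perm_snoc by (cases "b \<in> D") (simp_all only: if_True if_False bij_comp bij_transpose)
qed

lemma word_perm_permutes: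
  assumes "\<And>b. b \<in> set L \<inter> D \<Longrightarrow> 1 \<le> box_pos b \<and> box_pos b < N"
  shows "word_perm D L permutes {1..N}"
  using assms
proof (induction L rule: rev_induct)
  case Nil
  show ?case unfolding word_perm_Nil by (rule permutes_id)
next
  case (snoc b L)
  then have L: "word_perm D L permutes {1..N}" by simp
  show ?case
  proof (cases "b \<in> D")
    case True
    then have "transpose (box_pos b) (Suc (box_pos b)) permutes {1..N}"
      using snoc.prems[of b] by (intro permutes_swap_id) auto
    with L True show ?thesis unfolding word_perm_snoc by (simp only: if_True permutes_compose)
  next
    case False
    with L show ?thesis by simp
  qed
qed

section \<open>Reducedness and repeated exchanges\<close>

lemma transpose_Suc_less_iff:
  assumes "a \<noteq> b" "{a, b} \<noteq> {i, Suc i}"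
  shows "transpose i (Suc i) a < transpose i (Suc i) b \<longleftrightarrow> a < b"
proof -
  have "\<not> (a = i \<and> b = Suc i)" "\<not> (a = Suc i \<and> b = i)"
    using assms(2) by blast+
  then show ?thesis
    using assms(1) by (cases "a = i"; cases "a = Suc i"; cases "b = i"; cases "b = Suc i") (simp_all, linarith+)
qed

text \<open>At the start \<open>x\<close> stands to the left of \<open>y\<close>. A box that
  exchanges these two values reverses their order, and an adjacent transposition of any other pair
  preserves it. The inverse gives the position of a value.\<close>

lemma even_swaps_iff:
  assumes "distinct L" "x < y"
  shows "even (card (swaps D L x y)) \<longleftrightarrow>
    inv_into UNIV (word_perm D L) x < inv_into UNIV (word_perm D L) y"
  using assms(1)
proof (induction L rule: rev_induct)
  case Nil
  then show ?case using assms(2) by simp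
next
  case (snoc b L)
  let ?\<pi> = "word_perm D L" and ?i = "box_pos b"
  let ?s = "transpose ?i (Suc ?i)"
  have IH: "even (card (swaps D L x y)) \<longleftrightarrow> inv_into UNIV ?\<pi> x < inv_into UNIV ?\<pi> y"
    using snoc by simp
  have bij: "bij ?\<pi>" by (rule bij_word_perm)
  have inv: "inv_into UNIV ?\<pi> (?\<pi> k) = k" for k
    by (rule inv_f_f[OF bij_is_inj[OF bij]])
  have surj: "?\<pi> (inv_into UNIV ?\<pi> z) = z" for z
    by (rule surj_f_inv_f[OF bij_is_surj[OF bij]])
  have fin: "finite (swaps D L x y)"
    by (rule finite_subset[OF swaps_subset]) simp
  have b: "b \<notin> swaps D L x y"
    using swaps_subset[of D L x y] snoc.prems by auto
  show ?case
  proof (cases "b \<in> D")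
    case False
    then show ?thesis using IH by (simp add: swaps_snoc)
  next
    case True
    have inv': "inv_into UNIV (word_perm D (L @ [b])) z = ?s (inv_into UNIV ?\<pi> z)" for z
      using True bij by (simp add: o_inv_distrib)
    show ?thesis
    proof (cases "{?\<pi> ?i, ?\<pi> (Suc ?i)} = {x, y}")
      case True
      then have "x = ?\<pi> ?i \<and> y = ?\<pi> (Suc ?i) \<or> x = ?\<pi> (Suc ?i) \<and> y = ?\<pi> ?i"
        by (auto simp: doubleton_eq_iff)
      then have "inv_into UNIV ?\<pi> x = ?i \<and> inv_into UNIV ?\<pi> y = Suc ?i \<or>
        inv_into UNIV ?\<pi> x = Suc ?i \<and> inv_into UNIV ?\<pi> y = ?i"
        using inv by auto
      then show ?thesis
        using IH True \<open>b \<in> D\<close> fin b by (auto simp: swaps_snoc inv' simp del: word_perm_snoc)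
    next
      case False
      have "inv_into UNIV ?\<pi> x \<noteq> inv_into UNIV ?\<pi> y"
        using assms(2) surj[of x] surj[of y] by auto
      moreover have "{inv_into UNIV ?\<pi> x, inv_into UNIV ?\<pi> y} \<noteq> {?i, Suc ?i}"
      proof
        assume "{inv_into UNIV ?\<pi> x, inv_into UNIV ?\<pi> y} = {?i, Suc ?i}"
        then have "?\<pi> ` {inv_into UNIV ?\<pi> x, inv_into UNIV ?\<pi> y} = ?\<pi> ` {?i, Suc ?i}"
          by (rule arg_cong)
        with False show False by (simp add: surj)
      qed
      ultimately show ?thesis
        using IH False by (simp add: swaps_snoc inv' transpose_Suc_less_iff del: word_perm_snoc)
    qed
  qed
qed

text \<open>By parity, an ascending exchange is preceded by an even number of exchanges of the same
  pair, a descending one by an odd number. If no pair has been exchanged twice so far, "even" means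
  none, and a descending exchange would be at least the second.\<close>

lemma reduced_word_iff_swaps:
  assumes "distinct L"
  shows "reduced_word D L \<longleftrightarrow> (\<forall>x y. x < y \<longrightarrow> card (swaps D L x y) \<le> 1)"
  using assms
proof (induction L rule: rev_induct)
  case Nil
  show ?case by simp
next
  case (snoc b L)
  let ?\<pi> = "word_perm D L" and ?i = "box_pos b"
  have IH: "reduced_word D L \<longleftrightarrow> (\<forall>x y. x < y \<longrightarrow> card (swaps D L x y) \<le> 1)"
    using snoc by simp
  have bij: "bij ?\<pi>" by (rule bij_word_perm)
  have inv: "inv_into UNIV ?\<pi> (?\<pi> k) = k" for k
    by (rule inv_f_f[OF bij_is_inj[OF bij]])
  have neq: "?\<pi> ?i \<noteq> ?\<pi> (Suc ?i)"
    using inv[of ?i] inv[of "Suc ?i"] by auto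
  have fin: "finite (swaps D L x y)" for x y
    by (rule finite_subset[OF swaps_subset]) simp
  have b: "b \<notin> swaps D L x y" for x y
    using swaps_subset[of D L x y] snoc.prems by auto
  have par: "even (card (swaps D L x y)) \<longleftrightarrow> inv_into UNIV ?\<pi> x < inv_into UNIV ?\<pi> y" if "x < y" for x y
    using snoc.prems that by (intro even_swaps_iff) auto
  show ?case
  proof (cases "b \<in> D")
    case False
    then show ?thesis using IH by (simp add: swaps_snoc)
  next
    case True
    show ?thesis
    proof
      assume red: "reduced_word D (L @ [b])"
      then have less: "?\<pi> ?i < ?\<pi> (Suc ?i)" and red': "reduced_word D L"
        using True by auto
      have "even (card (swaps D L (?\<pi> ?i) (?\<pi> (Suc ?i))))"
        using par[OF less] by (simp add: inv)
      moreover have "card (swaps D L (?\<pi> ?i) (?\<pi> (Suc ?i))) \<le> 1"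
        using IH red' less by blast
      ultimately have zero: "card (swaps D L (?\<pi> ?i) (?\<pi> (Suc ?i))) = 0"
        using le_eq_less_or_eq by auto
      show "\<forall>x y. x < y \<longrightarrow> card (swaps D (L @ [b]) x y) \<le> 1"
      proof (intro allI impI)
        fix x y :: nat assume "x < y"
        show "card (swaps D (L @ [b]) x y) \<le> 1"
        proof (cases "{?\<pi> ?i, ?\<pi> (Suc ?i)} = {x, y}")
          case eq: True
          then have "x = ?\<pi> ?i" "y = ?\<pi> (Suc ?i)"
            using less \<open>x < y\<close> by (auto simp: doubleton_eq_iff)
          then show ?thesis using zero fin[of x y] b[of x y] by (auto simp: swaps_snoc)
        next
          case False
          then show ?thesis using IH red' \<open>x < y\<close> by (auto simp: swaps_snoc)
        qed
      qed
    next
      assume le: "\<forall>x y. x < y \<longrightarrow> card (swaps D (L @ [b]) x y) \<le> 1"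
      have mono: "card (swaps D L x y) \<le> card (swaps D (L @ [b]) x y)" for x y
        by (rule card_mono) (auto simp: swaps_snoc fin)
      have red': "reduced_word D L"
        using IH le mono le_trans by blast
      have "?\<pi> ?i < ?\<pi> (Suc ?i)"
      proof (rule ccontr)
        assume "\<not> ?\<pi> ?i < ?\<pi> (Suc ?i)"
        then have less: "?\<pi> (Suc ?i) < ?\<pi> ?i" using neq by simp
        have "card (swaps D (L @ [b]) (?\<pi> (Suc ?i)) (?\<pi> ?i)) =
          Suc (card (swaps D L (?\<pi> (Suc ?i)) (?\<pi> ?i)))"
          using True fin b by (simp add: swaps_snoc insert_commute)
        then have "card (swaps D L (?\<pi> (Suc ?i)) (?\<pi> ?i)) = 0"
          using le less by (metis Suc_le_mono One_nat_def le_zero_eq)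
        then show False using par[OF less] by (simp add: inv)
      qed
      with red' show "reduced_word D (L @ [b])" by simp
    qed
  qed
qed

section \<open>Expansion of the nilCoxeter product over subwords\<close>

lemma word_op_snoc:
  "word_op t (L @ [b]) f = nil_factor (box_pos b) (t b) (word_op t L f)"
  by (cases b) (simp add: word_op_def box_pos_def)

text \<open>Induction on the last box \<open>b\<close>: the two terms of \<open>nil_factor\<close>
  collect the subwords without and with \<open>b\<close>. A descent of \<open>w\<close> at the
  position of \<open>b\<close> is an ascent of the permutation before \<open>b\<close>, as
  reducedness requires.\<close>

lemma word_op_eq_sum:
  assumes "distinct L"
  shows "word_op t L (\<lambda>w. if w = id then 1 else 0) w =
    (\<Sum>D | D \<subseteq> set L \<and> reduced_word D L \<and> word_perm D L = w. \<Prod>b\<in>D. t b)"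
  using assms
proof (induction L arbitrary: w rule: rev_induct)
  case Nil
  have "{D. D = {} \<and> id = w} = (if w = id then {{}} else {})" by auto
  then show ?case by simp
next
  case (snoc b L)
  let ?S = "\<lambda>w. {D. D \<subseteq> set L \<and> reduced_word D L \<and> word_perm D L = w}"
  let ?s = "transpose (box_pos b) (Suc (box_pos b))"
  let ?T = "if w (Suc (box_pos b)) < w (box_pos b) then insert b ` ?S (w \<circ> ?s) else {}"
  have b: "b \<notin> set L" and L: "distinct L" using snoc.prems by auto
  have fin: "finite (?S v)" for v by (rule finite_subset[of _ "Pow (set L)"]) auto
  have cong: "word_perm (insert b D) L = word_perm D L"
    "reduced_word (insert b D) L = reduced_word D L" for D
    using b by (auto intro!: word_perm_cong reduced_word_cong)
  have eq: "v \<circ> ?s = w \<longleftrightarrow> v = w \<circ> ?s" for v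
    by (auto simp: comp_assoc)
  have U: "{D. D \<subseteq> set (L @ [b]) \<and> reduced_word D (L @ [b]) \<and> word_perm D (L @ [b]) = w} = ?S w \<union> ?T"
    (is "?U = _")
  proof (intro subset_antisym subsetI)
    fix D assume D: "D \<in> ?U"
    show "D \<in> ?S w \<union> ?T"
    proof (cases "b \<in> D")
      case False
      then show ?thesis using D by auto
    next
      case True
      define E where "E = D - {b}"
      have DE: "D = insert b E" using True by (auto simp: E_def)
      have E: "E \<subseteq> set L" using D by (auto simp: E_def)
      have "word_perm E L = w \<circ> ?s" "reduced_word E L"
        "word_perm E L (box_pos b) < word_perm E L (Suc (box_pos b))"
        using D unfolding DE by (auto simp: cong eq)
      with E show ?thesis unfolding DE by auto
    qed
  next
    fix D assume "D \<in> ?S w \<union> ?T"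
    then consider "D \<in> ?S w" | E where "D = insert b E" "E \<in> ?S (w \<circ> ?s)" "w (Suc (box_pos b)) < w (box_pos b)"
      by (auto split: if_splits)
    then show "D \<in> ?U"
    proof cases
      case 1
      then have "b \<notin> D" using b by auto
      with 1 show ?thesis by auto
    next
      case 2
      then show ?thesis by (auto simp: cong comp_assoc)
    qed
  qed
  have disj: "?S w \<inter> ?T = {}" using b by auto
  have sumT: "(\<Sum>D\<in>?T. \<Prod>b\<in>D. t b) =
    (if w (Suc (box_pos b)) < w (box_pos b) then t b * (\<Sum>D\<in>?S (w \<circ> ?s). \<Prod>b\<in>D. t b) else 0)"
  proof -
    have inj: "inj_on (insert b) (?S (w \<circ> ?s))"
      using b by (auto simp: inj_on_def insert_ident)
    have "(\<Prod>c\<in>insert b D. t c) = t b * (\<Prod>c\<in>D. t c)" if "D \<in> ?S (w \<circ> ?s)" for D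
      using that b finite_subset by (subst prod.insert) auto
    then show ?thesis by (simp add: sum.reindex[OF inj] sum_distrib_left)
  qed
  have "finite ?T" using fin by simp
  then have "(\<Sum>D\<in>?U. \<Prod>b\<in>D. t b) = (\<Sum>D\<in>?S w. \<Prod>b\<in>D. t b) + (\<Sum>D\<in>?T. \<Prod>b\<in>D. t b)"
    unfolding U by (intro sum.union_disjoint fin disj)
  then show ?case
    unfolding word_op_snoc nil_factor_def snoc.IH[OF L] sumT by (rule sym)
qed

section \<open>Pipes\<close>

text \<open>A pipe continues east if it enters a cross from the west or an elbow from the south,
  which is the case where the two truth values agree.\<close>

fun next_state :: "(nat \<times> nat) set \<Rightarrow> (nat \<times> nat) \<times> side \<Rightarrow> (nat \<times> nat) \<times> side" where
  "next_state D ((q, p), s) =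
     (if ((q, p) \<in> D) = (s = West) then ((q, p + 1), West) else ((q - 1, p), South))"

text \<open>The counterpart of \<open>pipe\<close> seen from the exit: it attaches the exit column
  to an arbitrary state, whichever pipe passes through it.\<close>

inductive leads :: "(nat \<times> nat) set \<Rightarrow> (nat \<times> nat) \<times> side \<Rightarrow> nat \<Rightarrow> bool" for D where
  exit: "leads D ((0, x), South) x"
| step: "1 \<le> q \<Longrightarrow> leads D (next_state D ((q, p), s)) x \<Longrightarrow> leads D ((q, p), s) x"

inductive_cases leads_row_0: "leads D ((0, p), s) x"

lemma leads_unique: "leads D st x \<Longrightarrow> leads D st y \<Longrightarrow> x = y"
proof (induction arbitrary: y rule: leads.induct)
  case (exit x)
  then show ?case by (auto elim: leads_row_0)
next
  case (step q p s x)
  note IH = step.IH and q = step.hyps(1)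
  from step.prems show ?case
  proof cases
    case exit
    with q show ?thesis by simp
  next
    case step
    with IH show ?thesis by blast
  qed
qed

lemma pipe_leads_backward:
  "pipe D a c s \<Longrightarrow> leads D (c, s) x \<Longrightarrow> leads D ((a, 1), West) x"
proof (induction rule: pipe.induct)
  case start
  then show ?case .
next
  case (cross_west q p)
  then show ?case using leads.step[of q D p West x] by simp
next
  case (cross_south q p)
  then show ?case using leads.step[of q D p South x] by simp
next
  case (elbow_west q p)
  then show ?case using leads.step[of q D p West x] by simp
next
  case (elbow_south q p)
  then show ?case using leads.step[of q D p South x] by simp
qed

lemma exits_at_leads: "exits_at D a x \<Longrightarrow> leads D ((a, 1), West) x"
  unfolding exits_at_def by (erule pipe_leads_backward) (rule leads.exit)

lemma pipe_next_state:
  assumes "pipe D a (q, p) s" "1 \<le> q" "next_state D ((q, p), s) = (c, s')"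
  shows "pipe D a c s'"
  using assms pipe.cross_west[of D a q p] pipe.cross_south[of D a q p]
    pipe.elbow_west[of D a q p] pipe.elbow_south[of D a q p]
  by (cases s) (auto split: if_splits)

lemma pipe_leads_exit: "leads D (c, s) x \<Longrightarrow> pipe D a c s \<Longrightarrow> exits_at D a x"
proof (induction "(c, s)" x arbitrary: c s rule: leads.induct)
  case (exit x)
  then show ?case by (simp add: exits_at_def)
next
  case (step q p s x)
  obtain c' s' where n: "next_state D ((q, p), s) = (c', s')" by fastforce
  have "pipe D a c' s'" by (rule pipe_next_state[OF step.prems step.hyps(1) n])
  then show ?case using step.hyps(3) n by blast
qed

lemma exits_at_iff_leads: "exits_at D a x \<longleftrightarrow> leads D ((a, 1), West) x"
  using exits_at_leads pipe_leads_exit pipe.start by blast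

text \<open>A state is determined by its successor, so a pipe can be traced backwards from its exit.\<close>

lemma pipe_previous_state:
  assumes "pipe D a c s'" "next_state D ((q, p), s) = (c, s')" "1 \<le> q" "1 \<le> p"
  shows "pipe D a (q, p) s"
  using assms(1)
proof (cases rule: pipe.cases)
  case start
  \<comment> \<open>The initial state could only succeed a state in column 0, which
    \<open>1 \<le> p\<close> excludes.\<close>
  then show ?thesis using assms by (auto split: if_splits)
next
  case (cross_west q' p')
  then show ?thesis using assms by (cases s) (auto split: if_splits)
next
  case (cross_south q' p')
  then have "q' = q" "p' = p" using assms by (auto split: if_splits)
  then show ?thesis using assms cross_south by (cases s) (auto split: if_splits)
next
  case (elbow_west q' p')
  then have "q' = q" "p' = p" using assms by (auto split: if_splits)
  then show ?thesis using assms elbow_west by (cases s) (auto split: if_splits)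
next
  case (elbow_south q' p')
  then show ?thesis using assms by (cases s) (auto split: if_splits)
qed

lemma leads_imp_pipe:
  assumes "leads D st x" "exits_at D a x" "1 \<le> snd (fst st)"
  shows "pipe D a (fst st) (snd st)"
  using assms
proof (induction rule: leads.induct)
  case (exit x)
  then show ?case by (simp add: exits_at_def)
next
  case (step q p s x)
  obtain c' s' where n: "next_state D ((q, p), s) = (c', s')" by fastforce
  have "1 \<le> snd c'" using step.prems n by (auto split: if_splits)
  then have "pipe D a c' s'" using step n by simp
  then show ?case using pipe_previous_state[OF _ n] step by simp
qed

text \<open>Tracing is deterministic in both directions, so a pipe is recognised in any state by its
  exit column.\<close>

lemma pipe_iff_leads:
  assumes "exits_at D a x" "leads D (c, s) y" "1 \<le> snd c"
  shows "pipe D a c s \<longleftrightarrow> x = y"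
proof
  assume "pipe D a c s"
  then have "leads D ((a, 1), West) y" using assms(2) by (rule pipe_leads_backward)
  then show "x = y" using assms(1) leads_unique exits_at_iff_leads by blast
next
  assume "x = y"
  then show "pipe D a c s" using leads_imp_pipe[of D "(c, s)" y a] assms by simp
qed

section \<open>Exit columns and subwords\<close>

text \<open>
  \<open>row_inv\<close> is the state after the rows \<open>1, \<dots>, q\<close>; \<open>box_inv\<close> is the state inside row \<open>q\<close> with
  the columns \<open>1, \<dots>, p\<close> still to be processed.
\<close>

definition row_inv :: "(nat \<times> nat) set \<Rightarrow> nat \<Rightarrow> (nat \<Rightarrow> nat) \<Rightarrow> bool" where
  "row_inv D q \<pi> \<longleftrightarrow> (\<forall>a. 1 \<le> a \<and> a \<le> q \<longrightarrow> leads D ((a, 1), West) (\<pi> a)) \<and>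
     (\<forall>p\<ge>1. leads D ((q, p), South) (\<pi> (q + p)))"

definition box_inv :: "(nat \<times> nat) set \<Rightarrow> nat \<Rightarrow> nat \<Rightarrow> (nat \<Rightarrow> nat) \<Rightarrow> bool" where
  "box_inv D q p \<pi> \<longleftrightarrow> (\<forall>a. 1 \<le> a \<and> a < q \<longrightarrow> leads D ((a, 1), West) (\<pi> a)) \<and>
     (\<forall>p'. 1 \<le> p' \<and> p' \<le> p \<longrightarrow> leads D ((q - 1, p'), South) (\<pi> (q + p' - 1))) \<and>
     leads D ((q, Suc p), West) (\<pi> (q + p)) \<and>
     (\<forall>p'>p. leads D ((q, p'), South) (\<pi> (q + p')))"

text \<open>The labels before a box is read belong to its outgoing edges: north at position q+p-1,
  east at position q+p.\<close>

definition labelled :: "(nat \<times> nat) set \<Rightarrow> (nat \<times> nat) list \<Rightarrow> bool" where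
  "labelled D L \<longleftrightarrow> (\<forall>L1 q p L2. L = L1 @ (q, p) # L2 \<longrightarrow>
     leads D ((q - 1, p), South) (word_perm D L1 (box_pos (q, p))) \<and>
     leads D ((q, Suc p), West) (word_perm D L1 (Suc (box_pos (q, p)))))"

lemma labelled_Nil: "labelled D []"
  by (simp add: labelled_def)

lemma labelled_snoc:
  "labelled D (L @ [(q, p)]) \<longleftrightarrow> labelled D L \<and>
     leads D ((q - 1, p), South) (word_perm D L (box_pos (q, p))) \<and>
     leads D ((q, Suc p), West) (word_perm D L (Suc (box_pos (q, p))))"
  unfolding labelled_def snoc_eq_append_Cons by blast

lemma row_inv_0: "row_inv D 0 id"
  by (auto simp: row_inv_def intro: leads.exit)

text \<open>Beyond column \<open>p\<close> the row has only elbows. Each hands the label of its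
  north edge to its west edge, and that of its east edge to its south edge, so the labels are passed
  on without being permuted.\<close>

lemma row_inv_imp_box_inv:
  assumes "row_inv D q \<pi>" and empty: "\<And>p'. p < p' \<Longrightarrow> (Suc q, p') \<notin> D"
  shows "box_inv D (Suc q) p \<pi>"
proof -
  have S: "leads D ((q, p'), South) (\<pi> (q + p'))" if "1 \<le> p'" for p'
    using assms(1) that by (simp add: row_inv_def)
  have W: "leads D ((Suc q, p'), West) (\<pi> (q + p'))" if "p < p'" for p'
    using S[of p'] that empty by (intro leads.step) auto
  have "leads D ((Suc q, p'), South) (\<pi> (Suc q + p'))" if "p < p'" for p'
    using W[of "Suc p'"] that empty by (intro leads.step) auto
  then show ?thesis
    using assms(1) S W[of "Suc p"] by (auto simp: box_inv_def row_inv_def)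
qed

lemma box_inv_imp_row_inv:
  assumes "box_inv D q 0 \<pi>"
  shows "row_inv D q \<pi>"
  using assms unfolding box_inv_def row_inv_def by (auto simp: le_less)

text \<open>Only the positions \<open>q + p\<close> and \<open>q + p + 1\<close> are affected. The
  west and south edges of the box receive the labels of its north and east edges, in this order for
  an elbow and exchanged for a cross.\<close>

lemma box_inv_step:
  assumes "box_inv D q (Suc p) (word_perm D L)" "1 \<le> q"
  shows "box_inv D q p (word_perm D (L @ [(q, Suc p)]))"
proof -
  let ?\<pi> = "word_perm D L" and ?\<pi>' = "word_perm D (L @ [(q, Suc p)])"
  have inv: "\<And>a. 1 \<le> a \<Longrightarrow> a < q \<Longrightarrow> leads D ((a, 1), West) (?\<pi> a)"
    "\<And>p'. 1 \<le> p' \<Longrightarrow> p' \<le> Suc p \<Longrightarrow> leads D ((q - 1, p'), South) (?\<pi> (q + p' - 1))"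
    "leads D ((q, Suc (Suc p)), West) (?\<pi> (Suc (q + p)))"
    "\<And>p'. Suc p < p' \<Longrightarrow> leads D ((q, p'), South) (?\<pi> (q + p'))"
    using assms(1) by (auto simp: box_inv_def)
  have same: "?\<pi>' i = ?\<pi> i" if "i < q + p \<or> Suc (q + p) < i" for i
    using that by (auto simp: box_pos_def transpose_def)
  have S: "leads D ((q - 1, Suc p), South) (?\<pi> (q + p))"
    using inv(2)[of "Suc p"] by simp
  have W': "leads D ((q, Suc p), West) (?\<pi>' (q + p))"
    using S inv(3) assms(2) by (intro leads.step) (auto simp: box_pos_def)
  have S': "leads D ((q, Suc p), South) (?\<pi>' (Suc (q + p)))"
    using S inv(3) assms(2) by (intro leads.step) (auto simp: box_pos_def)
  have "leads D ((q, p'), South) (?\<pi>' (q + p'))" if "p < p'" for p'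
  proof (cases "p' = Suc p")
    case True
    then show ?thesis using S' by simp
  next
    case False
    then show ?thesis using inv(4)[of p'] same[of "q + p'"] that by simp
  qed
  moreover have "leads D ((a, 1), West) (?\<pi>' a)" if "1 \<le> a" "a < q" for a
    using inv(1)[OF that] same[of a] that by simp
  moreover have "leads D ((q - 1, p'), South) (?\<pi>' (q + p' - 1))" if "1 \<le> p'" "p' \<le> p" for p'
  proof -
    have "q + p' - 1 < q + p" using that by linarith
    then show ?thesis using inv(2)[of p'] same[of "q + p' - 1"] that by (simp del: word_perm_snoc)
  qed
  ultimately show ?thesis
    using W' unfolding box_inv_def by blast
qed

lemma row_invariant:
  assumes "box_inv D q k (word_perm D L)" "labelled D L" "1 \<le> q"
  shows "box_inv D q 0 (word_perm D (L @ row_boxes q k)) \<and> labelled D (L @ row_boxes q k)"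
  using assms
proof (induction k arbitrary: L)
  case 0
  then show ?case by simp
next
  case (Suc k)
  have "leads D ((q - 1, Suc k), South) (word_perm D L (box_pos (q, Suc k)))"
    "leads D ((q, Suc (Suc k)), West) (word_perm D L (Suc (box_pos (q, Suc k))))"
    using Suc.prems(1,3) by (auto simp: box_inv_def box_pos_def)
  then have "labelled D (L @ [(q, Suc k)])"
    using Suc.prems(2) by (simp add: labelled_snoc)
  then show ?case
    using Suc.IH[OF box_inv_step[OF Suc.prems(1,3)]] Suc.prems(3) by simp
qed

lemma stair_invariant:
  assumes "pipe_dream N D"
  shows "row_inv D m (word_perm D (stair_boxes N m)) \<and> labelled D (stair_boxes N m)"
proof (induction m)
  case 0
  show ?case using row_inv_0 labelled_Nil by (simp only: stair_boxes.simps word_perm_Nil)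
next
  case (Suc m)
  \<comment> \<open>The staircase condition enters here: to the right of the listed boxes the row
    has no crosses.\<close>
  have "(Suc m, p') \<notin> D" if "N - Suc m < p'" for p'
    using assms that by (auto simp: pipe_dream_def)
  then have "box_inv D (Suc m) (N - Suc m) (word_perm D (stair_boxes N m))"
    using Suc row_inv_imp_box_inv by blast
  then show ?case
    using row_invariant[of D "Suc m" "N - Suc m" "stair_boxes N m"] Suc box_inv_imp_row_inv
    by simp
qed

section \<open>Reduced pipe dreams as reduced subwords of the staircase\<close>

lemma exits_at_word_perm:
  assumes "pipe_dream N D" "1 \<le> a" "a \<le> N"
  shows "exits_at D a (word_perm D (stair_boxes N N) a)"
  using stair_invariant[OF assms(1), of N] assms by (simp add: row_inv_def exits_at_iff_leads)

text \<open>A pipe goes straight through a cross, so the labels of the outgoing edges pass to the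
  opposite incoming edges.\<close>

lemma box_labels:
  assumes "pipe_dream N D" "(q, p) \<in> D" "stair_boxes N N = L1 @ (q, p) # L2"
  shows "leads D ((q, p), South) (word_perm D L1 (box_pos (q, p)))"
    and "leads D ((q, p), West) (word_perm D L1 (Suc (box_pos (q, p))))"
proof -
  have "1 \<le> q" using assms by (auto simp: pipe_dream_def)
  moreover have "leads D ((q - 1, p), South) (word_perm D L1 (box_pos (q, p)))"
    "leads D ((q, Suc p), West) (word_perm D L1 (Suc (box_pos (q, p))))"
    using stair_invariant[OF assms(1), of N] assms(3) by (auto simp: labelled_def)
  ultimately show "leads D ((q, p), South) (word_perm D L1 (box_pos (q, p)))"
    "leads D ((q, p), West) (word_perm D L1 (Suc (box_pos (q, p))))"
    using assms(2) by (auto intro: leads.step)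
qed

lemma pipe_dream_box_pos:
  "pipe_dream N D \<Longrightarrow> b \<in> D \<Longrightarrow> 1 \<le> box_pos b \<and> box_pos b < N"
  by (cases b) (auto simp: pipe_dream_def box_pos_def)

lemma pipe_dream_word_perm_permutes:
  "pipe_dream N D \<Longrightarrow> word_perm D L permutes {1..N}"
  by (rule word_perm_permutes) (auto dest: pipe_dream_box_pos)

lemma pipe_dream_subset: "pipe_dream N D \<longleftrightarrow> D \<subseteq> set (stair_boxes N N)"
  by (auto simp: pipe_dream_def set_stair_boxes)

lemma crossings_eq_swaps:
  assumes D: "pipe_dream N D" and a: "a \<in> {1..N}" and b: "b \<in> {1..N}"
    and v: "v = word_perm D (stair_boxes N N)"
  shows "crossings D a b = swaps D (stair_boxes N N) (v a) (v b)"
proof (rule Set.set_eqI)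
  fix c
  show "c \<in> crossings D a b \<longleftrightarrow> c \<in> swaps D (stair_boxes N N) (v a) (v b)"
  proof (cases "c \<in> D")
    case False
    then show ?thesis by (simp add: crossings_def swaps_def)
  next
    case True
    obtain q p where c: "c = (q, p)" by fastforce
    have p: "1 \<le> snd c" using True D c by (auto simp: pipe_dream_def)
    have "c \<in> set (stair_boxes N N)" using True D pipe_dream_subset by blast
    then obtain L1 L2 where L: "stair_boxes N N = L1 @ c # L2" by (meson split_list)
    \<comment> \<open>No box is listed twice, so the prefix before \<open>c\<close>, and with it the
      pair of exchanged labels, is determined.\<close>
    have uniq: "M1 = L1" if "stair_boxes N N = M1 @ c # M2" for M1 M2
      using that L distinct_stair_boxes[of N N] by (auto simp: append_eq_append_conv2 append_eq_Cons_conv Cons_eq_append_conv)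
    let ?x = "word_perm D L1 (box_pos c)" and ?y = "word_perm D L1 (Suc (box_pos c))"
    have lab: "leads D (c, South) ?x" "leads D (c, West) ?y"
      using box_labels[OF D] True L c by auto
    have ex: "exits_at D a (v a)" "exits_at D b (v b)"
      using exits_at_word_perm[OF D] a b v by auto
    have "c \<in> crossings D a b \<longleftrightarrow> v a = ?y \<and> v b = ?x \<or> v a = ?x \<and> v b = ?y"
      using True pipe_iff_leads[OF ex(1) lab(1) p] pipe_iff_leads[OF ex(1) lab(2) p]
        pipe_iff_leads[OF ex(2) lab(1) p] pipe_iff_leads[OF ex(2) lab(2) p]
      by (simp add: crossings_def)
    also have "\<dots> \<longleftrightarrow> {?x, ?y} = {v a, v b}"
      by (auto simp: doubleton_eq_iff)
    also have "\<dots> \<longleftrightarrow> c \<in> swaps D (stair_boxes N N) (v a) (v b)"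
      using True L uniq unfolding swaps_def by blast
    finally show ?thesis .
  qed
qed

lemma swaps_labels_in_range:
  assumes "pipe_dream N D" "c \<in> swaps D L x y"
  shows "x \<in> {1..N} \<and> y \<in> {1..N}"
proof -
  obtain L1 where c: "c \<in> D"
    "{word_perm D L1 (box_pos c), word_perm D L1 (Suc (box_pos c))} = {x, y}"
    using assms(2) by (auto simp: swaps_def)
  have "box_pos c \<in> {1..N}" "Suc (box_pos c) \<in> {1..N}"
    using pipe_dream_box_pos[OF assms(1) c(1)] by auto
  then have "word_perm D L1 (box_pos c) \<in> {1..N}" "word_perm D L1 (Suc (box_pos c)) \<in> {1..N}"
    using permutes_in_image[OF pipe_dream_word_perm_permutes[OF assms(1)]] by blast+
  then show ?thesis using c(2) unfolding doubleton_eq_iff by auto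
qed

text \<open>The permutation \<open>v\<close> translates pairs of pipes into pairs of exit columns;
  labels outside \<open>{1..N}\<close> are never exchanged.\<close>

lemma reduced_pipe_dream_iff:
  assumes D: "pipe_dream N D"
  shows "reduced_pipe_dream N D \<longleftrightarrow> reduced_word D (stair_boxes N N)"
proof -
  let ?L = "stair_boxes N N"
  define v where "v = word_perm D ?L"
  have v: "v permutes {1..N}" unfolding v_def by (rule pipe_dream_word_perm_permutes[OF D])
  have cr: "crossings D a b = swaps D ?L (v a) (v b)" if "a \<in> {1..N}" "b \<in> {1..N}" for a b
    using crossings_eq_swaps[OF D that v_def] .
  have sym: "swaps D ?L x y = swaps D ?L y x" for x y
    unfolding swaps_def by (simp add: insert_commute)
  have "reduced_pipe_dream N D \<longleftrightarrow> (\<forall>x y. x < y \<longrightarrow> card (swaps D ?L x y) \<le> 1)"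
  proof
    assume red: "reduced_pipe_dream N D"
    show "\<forall>x y. x < y \<longrightarrow> card (swaps D ?L x y) \<le> 1"
    proof (intro allI impI)
      fix x y :: nat assume xy: "x < y"
      show "card (swaps D ?L x y) \<le> 1"
      proof (cases "swaps D ?L x y = {}")
        case False
        then have "x \<in> v ` {1..N}" "y \<in> v ` {1..N}"
          unfolding permutes_image[OF v] using swaps_labels_in_range[OF D] by blast+
        then obtain a b where ab: "a \<in> {1..N}" "v a = x" "b \<in> {1..N}" "v b = y"
          by blast
        then have "a \<noteq> b" using xy by auto
        then show ?thesis using red ab cr by (auto simp: reduced_pipe_dream_def)
      qed simp
    qed
  next
    assume le: "\<forall>x y. x < y \<longrightarrow> card (swaps D ?L x y) \<le> 1"
    have "card (crossings D a b) \<le> 1" if ab: "a \<in> {1..N}" "b \<in> {1..N}" "a \<noteq> b" for a b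
    proof -
      have "v a \<noteq> v b" using ab(3) permutes_inj[OF v] by (auto dest: injD)
      then have "card (swaps D ?L (v a) (v b)) \<le> 1"
        using le sym by (metis linorder_neqE_nat)
      then show ?thesis using cr ab by simp
    qed
    then show "reduced_pipe_dream N D" using D by (auto simp: reduced_pipe_dream_def)
  qed
  also have "\<dots> \<longleftrightarrow> reduced_word D ?L"
    by (rule reduced_word_iff_swaps[OF distinct_stair_boxes, symmetric])
  finally show ?thesis .
qed

lemma RP_eq_subwords:
  assumes w: "w permutes {1..N}"
  shows "RP N w = {D. D \<subseteq> set (stair_boxes N N) \<and> reduced_word D (stair_boxes N N) \<and>
    word_perm D (stair_boxes N N) = w}"
proof (rule Set.set_eqI)
  fix D
  show "D \<in> RP N w \<longleftrightarrow> D \<in> {D. D \<subseteq> set (stair_boxes N N) \<and>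
    reduced_word D (stair_boxes N N) \<and> word_perm D (stair_boxes N N) = w}"
  proof (cases "pipe_dream N D")
    case False
    then show ?thesis
      using pipe_dream_subset[of N D] by (auto simp: RP_def reduced_pipe_dream_def)
  next
    case True
    let ?v = "word_perm D (stair_boxes N N)"
    have v: "?v permutes {1..N}" by (rule pipe_dream_word_perm_permutes[OF True])
    have "(\<forall>q\<in>{1..N}. exits_at D q (w q)) \<longleftrightarrow> ?v = w"
    proof
      assume "\<forall>q\<in>{1..N}. exits_at D q (w q)"
      then have "?v q = w q" if "q \<in> {1..N}" for q
        using that exits_at_word_perm[OF True, of q] leads_unique by (auto simp: exits_at_iff_leads)
      moreover have "?v q = w q" if "q \<notin> {1..N}" for q
        using permutes_not_in[OF v that] permutes_not_in[OF w that] by simp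
      ultimately show "?v = w" by blast
    next
      assume "?v = w"
      then show "\<forall>q\<in>{1..N}. exits_at D q (w q)" using exits_at_word_perm[OF True] by auto
    qed
    then show ?thesis
      using True pipe_dream_subset[of N D] reduced_pipe_dream_iff[OF True] by (simp add: RP_def)
  qed
qed

lemma schubert_gen_eq_sum_RP:
  assumes "w permutes {1..N}"
  shows "schubert_gen N t w = (\<Sum>D\<in>RP N w. \<Prod>b\<in>D. t b)"
  unfolding schubert_gen_def word_op_eq_sum[OF distinct_stair_boxes] RP_eq_subwords[OF assms] ..

section \<open>Substitution homomorphisms\<close>

definition monomial_subst :: "('a var \<Rightarrow> 'b xypoly) \<Rightarrow> ('a var \<Rightarrow>\<^sub>0 nat) \<Rightarrow> 'b xypoly" where
  "monomial_subst \<sigma> m = (\<Prod>v\<in>Poly_Mapping.keys m. \<sigma> v ^ Poly_Mapping.lookup m v)"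

lemma monomial_subst_superset:
  "finite S \<Longrightarrow> Poly_Mapping.keys m \<subseteq> S \<Longrightarrow>
    monomial_subst \<sigma> m = (\<Prod>v\<in>S. \<sigma> v ^ Poly_Mapping.lookup m v)"
  unfolding monomial_subst_def by (rule prod.mono_neutral_left) (auto simp: in_keys_iff)

lemma monomial_subst_add: "monomial_subst \<sigma> (m + m') = monomial_subst \<sigma> m * monomial_subst \<sigma> m'"
proof -
  let ?S = "Poly_Mapping.keys m \<union> Poly_Mapping.keys m'"
  have "Poly_Mapping.keys (m + m') \<subseteq> ?S" by (rule keys_add)
  then show ?thesis
    by (simp add: monomial_subst_superset[of ?S] lookup_add power_add prod.distrib)
qed

lemma poly_subst_superset:
  "finite S \<Longrightarrow> Poly_Mapping.keys P \<subseteq> S \<Longrightarrow>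
    poly_subst \<sigma> P = (\<Sum>m\<in>S. of_int (Poly_Mapping.lookup P m) * monomial_subst \<sigma> m)"
  unfolding poly_subst_def monomial_subst_def
  by (rule sum.mono_neutral_left) (auto simp: in_keys_iff)

lemma poly_subst_add: "poly_subst \<sigma> (P + Q) = poly_subst \<sigma> P + poly_subst \<sigma> Q"
proof -
  let ?S = "Poly_Mapping.keys P \<union> Poly_Mapping.keys Q"
  have "Poly_Mapping.keys (P + Q) \<subseteq> ?S" by (rule keys_add)
  then show ?thesis
    by (simp add: poly_subst_superset[of ?S] lookup_add distrib_right sum.distrib)
qed

lemma poly_subst_0 [simp]: "poly_subst \<sigma> 0 = 0"
  by (simp add: poly_subst_def)

lemma poly_subst_single:
  "poly_subst \<sigma> (Poly_Mapping.single m c) = of_int c * monomial_subst \<sigma> m"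
  by (simp add: poly_subst_superset[of "{m}"])

lemma poly_subst_1 [simp]: "poly_subst \<sigma> 1 = 1"
  using poly_subst_single[of \<sigma> 0 1] by (simp add: monomial_subst_def)

lemma poly_subst_Var [simp]: "poly_subst \<sigma> (Var v) = \<sigma> v"
  unfolding Var_def poly_subst_single by (simp add: monomial_subst_def)

lemma poly_subst_sum: "poly_subst \<sigma> (sum f A) = (\<Sum>a\<in>A. poly_subst \<sigma> (f a))"
  by (induction A rule: infinite_finite_induct) (simp_all add: poly_subst_add)

lemma poly_subst_diff: "poly_subst \<sigma> (P - Q) = poly_subst \<sigma> P - poly_subst \<sigma> Q"
  using poly_subst_add[of \<sigma> "P - Q" Q] by simp

lemma poly_mapping_eq_sum_single:
  "P = (\<Sum>m\<in>Poly_Mapping.keys P. Poly_Mapping.single m (Poly_Mapping.lookup P m))"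
proof (rule poly_mapping_eqI)
  fix k
  have "Poly_Mapping.lookup (\<Sum>m\<in>Poly_Mapping.keys P. Poly_Mapping.single m (Poly_Mapping.lookup P m)) k =
    (\<Sum>m\<in>Poly_Mapping.keys P. if m = k then Poly_Mapping.lookup P k else 0)"
    unfolding lookup_sum by (rule sum.cong) (auto simp: lookup_single)
  then show "Poly_Mapping.lookup P k =
    Poly_Mapping.lookup (\<Sum>m\<in>Poly_Mapping.keys P. Poly_Mapping.single m (Poly_Mapping.lookup P m)) k"
    by (simp add: in_keys_iff)
qed

lemma poly_subst_mult: "poly_subst \<sigma> (P * Q) = poly_subst \<sigma> P * poly_subst \<sigma> Q"
proof -
  have single: "poly_subst \<sigma> (Poly_Mapping.single m c * Poly_Mapping.single m' c') =
    poly_subst \<sigma> (Poly_Mapping.single m c) * poly_subst \<sigma> (Poly_Mapping.single m' c')" for m c m' c'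
    by (simp add: mult_single poly_subst_single monomial_subst_add)
  have "poly_subst \<sigma> (P * Q) =
    poly_subst \<sigma> ((\<Sum>m\<in>Poly_Mapping.keys P. Poly_Mapping.single m (Poly_Mapping.lookup P m)) *
      (\<Sum>m\<in>Poly_Mapping.keys Q. Poly_Mapping.single m (Poly_Mapping.lookup Q m)))"
    by (simp only: poly_mapping_eq_sum_single[symmetric])
  also have "\<dots> =
    poly_subst \<sigma> (\<Sum>m\<in>Poly_Mapping.keys P. Poly_Mapping.single m (Poly_Mapping.lookup P m)) *
    poly_subst \<sigma> (\<Sum>m\<in>Poly_Mapping.keys Q. Poly_Mapping.single m (Poly_Mapping.lookup Q m))"
    unfolding sum_product poly_subst_sum single ..
  finally show ?thesis
    by (simp only: poly_mapping_eq_sum_single[symmetric])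
qed

lemma poly_subst_prod: "poly_subst \<sigma> (prod f A) = (\<Prod>a\<in>A. poly_subst \<sigma> (f a))"
  by (induction A rule: infinite_finite_induct) (simp_all add: poly_subst_mult)

lemma Var_eq_iff [simp]: "Var u = Var v \<longleftrightarrow> u = v"
proof
  assume "Var u = Var v"
  then have "Poly_Mapping.keys (Var u) = Poly_Mapping.keys (Var v)" by simp
  then have "Poly_Mapping.single u (1::nat) = Poly_Mapping.single v 1" by (simp add: Var_def)
  then have "Poly_Mapping.keys (Poly_Mapping.single u (1::nat)) = Poly_Mapping.keys (Poly_Mapping.single v (1::nat))"
    by simp
  then show "u = v" by simp
qed simp

section \<open>Double Schubert polynomials as sums over pipe dreams\<close>

definition pipe_dream_sum :: "nat \<Rightarrow> (nat \<Rightarrow> nat) \<Rightarrow> nat xypoly" where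
  "pipe_dream_sum N w = (\<Sum>D\<in>RP N w. \<Prod>(i, j)\<in>D. Var (X i) - Var (Y j))"

text \<open>This is the coefficient of \<open>w\<close> in \<open>schubert_gen_transpose\<close>: at
  a descent the extra factor contributes the coefficient of w s_q, and on the other side the
  exchange of variables is applied to the weights.\<close>

lemma swap_x_pipe_dream_sum:
  assumes w: "w permutes {1..N}" and q: "1 \<le> q" "q < N" and desc: "w (Suc q) < w q"
  shows "pipe_dream_sum N w + (Var (X (Suc q)) - Var (X q)) * pipe_dream_sum N (w \<circ> transpose q (Suc q)) =
    swap_x q (pipe_dream_sum N w)"
proof -
  let ?t = "\<lambda>(i, j). Var (X i) - Var (Y j)"
  let ?t' = "\<lambda>(i, j). Var (X (transpose q (Suc q) i)) - Var (Y j)"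
  have ws: "w \<circ> transpose q (Suc q) permutes {1..N}"
    using w q by (intro permutes_compose permutes_swap_id) auto
  have gen: "schubert_gen N ?t v = pipe_dream_sum N v" if "v permutes {1..N}" for v
    unfolding schubert_gen_eq_sum_RP[OF that] pipe_dream_sum_def ..
  have tr: "transpose (X q) (X (Suc q)) (X i) = X (transpose q (Suc q) i)"
    "transpose (X q) (X (Suc q)) (Y j) = Y j" for i j :: nat
    by (simp_all add: transpose_def)
  have "swap_x q (pipe_dream_sum N w) = (\<Sum>D\<in>RP N w. \<Prod>b\<in>D. ?t' b)"
    unfolding pipe_dream_sum_def swap_x_def poly_subst_sum poly_subst_prod
    by (intro sum.cong prod.cong) (auto simp: poly_subst_diff tr)
  also have "\<dots> = schubert_gen N ?t' w"
    by (rule schubert_gen_eq_sum_RP[OF w, symmetric])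
  also have "\<dots> = nil_factor q (Var (X (Suc q)) - Var (X q)) (schubert_gen N ?t) w"
    using schubert_gen_transpose[OF q, of "\<lambda>i. Var (X i)" "\<lambda>j. Var (Y j)"] by simp
  also have "\<dots> = pipe_dream_sum N w +
    (Var (X (Suc q)) - Var (X q)) * pipe_dream_sum N (w \<circ> transpose q (Suc q))"
    using desc by (simp only: nil_factor_def gen[OF w] gen[OF ws] if_True)
  finally show ?thesis by (rule sym)
qed

text \<open>The quotient demanded by \<open>THE\<close> is unique because polynomials form an
  integral domain and x_q - x_{q+1} is nonzero.\<close>

lemma divided_difference_pipe_dream_sum:
  assumes "w permutes {1..N}" "1 \<le> q" "q < N" "w (Suc q) < w q"
  shows "divided_difference q (pipe_dream_sum N w) = pipe_dream_sum N (w \<circ> transpose q (Suc q))"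
  unfolding divided_difference_def
proof (rule the_equality)
  let ?x = "Var (X q) - Var (X (q + 1)) :: nat xypoly"
  show eq: "?x * pipe_dream_sum N (w \<circ> transpose q (Suc q)) =
    pipe_dream_sum N w - swap_x q (pipe_dream_sum N w)"
    unfolding swap_x_pipe_dream_sum[OF assms, symmetric] by (simp add: algebra_simps)
  fix Q assume "?x * Q = pipe_dream_sum N w - swap_x q (pipe_dream_sum N w)"
  then have "?x * Q = ?x * pipe_dream_sum N (w \<circ> transpose q (Suc q))" using eq by simp
  moreover have "?x \<noteq> 0" by simp
  ultimately show "Q = pipe_dream_sum N (w \<circ> transpose q (Suc q))"
    by (simp only: mult_cancel_left) blast
qed

text \<open>A potential that drops when an ascent of \<open>w\<close> is turned into a descent.\<close>

lemma weighted_sum_transpose: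
  fixes w :: "nat \<Rightarrow> nat"
  assumes "1 \<le> q" "q < N"
  shows "(\<Sum>i\<in>{1..N}. i * (w \<circ> transpose q (Suc q)) i) + w (Suc q) = (\<Sum>i\<in>{1..N}. i * w i) + w q"
proof -
  let ?R = "{1..N} - {q, Suc q}"
  have split: "(\<Sum>i\<in>{1..N}. f i) = f q + f (Suc q) + (\<Sum>i\<in>?R. f i)" for f :: "nat \<Rightarrow> nat"
  proof -
    have "{q, Suc q} \<subseteq> {1..N}" using assms by auto
    then have "(\<Sum>i\<in>{1..N}. f i) = (\<Sum>i\<in>?R. f i) + (\<Sum>i\<in>{q, Suc q}. f i)"
      by (intro sum.subset_diff) auto
    then show ?thesis by simp
  qed
  have "(\<Sum>i\<in>?R. i * (w \<circ> transpose q (Suc q)) i) = (\<Sum>i\<in>?R. i * w i)"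
    by (rule sum.cong) (auto simp: transpose_def)
  then show ?thesis
    unfolding split by (simp add: algebra_simps)
qed

text \<open>Injectivity makes the inequalities strict, whence i \<le> w(i) throughout; as both sides
  have the same sum over \<open>{1..N}\<close>, equality holds everywhere.\<close>

lemma permutes_ascending_imp_id:
  assumes w: "w permutes {1..N}" and asc: "\<And>q. 1 \<le> q \<Longrightarrow> q < N \<Longrightarrow> w q \<le> w (Suc q)"
  shows "w = id"
proof -
  have le: "Suc i \<le> N \<Longrightarrow> Suc i \<le> w (Suc i)" for i
  proof (induction i)
    case 0
    then show ?case using permutes_in_image[OF w, of 1] by simp
  next
    case (Suc i)
    have "w (Suc i) \<noteq> w (Suc (Suc i))"
      by (simp add: inj_eq[OF permutes_inj[OF w]])
    then show ?case using Suc asc[of "Suc i"] by simp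
  qed
  have le': "i \<le> w i" if "i \<in> {1..N}" for i
    using le[of "i - 1"] that by simp
  have "(\<Sum>i\<in>{1..N}. i) = (\<Sum>i\<in>{1..N}. w i)"
    using sum.permute[OF w, of "\<lambda>i. i"] by (simp add: o_def)
  then have eq: "i = w i" if "i \<in> {1..N}" for i
    by (rule sum_mono_inv) (use that le' in auto)
  show ?thesis
  proof (rule ext)
    fix i
    show "w i = id i"
      using eq[of i] permutes_not_in[OF w, of i] by (cases "i \<in> {1..N}") auto
  qed
qed

lemma longest_perm_permutes: "longest_perm N permutes {1..N}"
proof (rule bij_imp_permutes)
  show "bij_betw (longest_perm N) {1..N} {1..N}"
    by (rule bij_betw_byWitness[where f' = "longest_perm N"]) (auto simp: longest_perm_def)
qed (auto simp: longest_perm_def)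

lemma longest_perm_involution: "longest_perm N (longest_perm N i) = i"
  by (auto simp: longest_perm_def)

lemma permutes_descending_imp_longest:
  assumes w: "w permutes {1..N}" and desc: "\<And>q. 1 \<le> q \<Longrightarrow> q < N \<Longrightarrow> w (Suc q) \<le> w q"
  shows "w = longest_perm N"
proof -
  have "longest_perm N \<circ> w = id"
  proof (rule permutes_ascending_imp_id)
    show "longest_perm N \<circ> w permutes {1..N}"
      by (rule permutes_compose[OF w longest_perm_permutes])
    fix q assume q: "1 \<le> q" "q < N"
    then have "q \<in> {1..N}" "Suc q \<in> {1..N}" by auto
    then have "w q \<in> {1..N}" "w (Suc q) \<in> {1..N}"
      by (simp_all only: permutes_in_image[OF w])
    then show "(longest_perm N \<circ> w) q \<le> (longest_perm N \<circ> w) (Suc q)"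
      using desc[OF q] by (auto simp: longest_perm_def)
  qed
  then have "longest_perm N (w i) = i" for i by (simp add: fun_eq_iff)
  then have "w i = longest_perm N i" for i
    using longest_perm_involution[of N "w i"] by simp
  then show ?thesis by (rule ext)
qed

text \<open>
  If the sum for \<open>w\<close> vanished, so would the one for \<open>w s\<^sub>q\<close> at every descent \<open>q\<close>; descending to
  the identity, whose sum is \<open>1\<close>, gives a contradiction.
\<close>

lemma pipe_dream_sum_nonzero:
  assumes "w permutes {1..N}"
  shows "pipe_dream_sum N w \<noteq> 0"
  using assms
\<comment> \<open>The weighted sum grows when a descent is removed. It has \<open>N\<close> terms of
  size at most \<open>N * N\<close>, so its complement in \<open>N * (N * N)\<close> strictly
  decreases even with truncated subtraction.\<close>
proof (induction "N * (N * N) - (\<Sum>i\<in>{1..N}. i * w i)" arbitrary: w rule: less_induct)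
  case less
  show ?case
  proof (cases "\<exists>q. 1 \<le> q \<and> q < N \<and> w (Suc q) < w q")
    case False
    then have "w = id"
      using permutes_ascending_imp_id[OF less.prems] by (meson not_le_imp_less)
    moreover have "pipe_dream_sum N id = 1"
      using schubert_gen_id[of N "\<lambda>(i, j). Var (X i) - Var (Y j)"]
      unfolding schubert_gen_eq_sum_RP[OF permutes_id] pipe_dream_sum_def .
    ultimately show ?thesis by simp
  next
    case True
    then obtain q where q: "1 \<le> q" "q < N" and d: "w (Suc q) < w q" by blast
    let ?v = "w \<circ> transpose q (Suc q)"
    have v: "?v permutes {1..N}"
      using less.prems q by (intro permutes_compose permutes_swap_id) auto
    have "(\<Sum>i\<in>{1..N}. i * ?v i) \<le> (\<Sum>i\<in>{1..N}. N * N)"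
    proof (rule sum_mono)
      fix i assume i: "i \<in> {1..N}"
      then have "?v i \<in> {1..N}" by (simp only: permutes_in_image[OF v])
      with i show "i * ?v i \<le> N * N" by (intro mult_le_mono) auto
    qed
    then have "(\<Sum>i\<in>{1..N}. i * ?v i) \<le> N * (N * N)" by simp
    moreover have "(\<Sum>i\<in>{1..N}. i * w i) < (\<Sum>i\<in>{1..N}. i * ?v i)"
      using weighted_sum_transpose[OF q, of w] d by linarith
    ultimately have "N * (N * N) - (\<Sum>i\<in>{1..N}. i * ?v i) < N * (N * N) - (\<Sum>i\<in>{1..N}. i * w i)"
      by linarith
    then have "pipe_dream_sum N ?v \<noteq> 0"
      using v by (rule less.hyps)
    show ?thesis
    proof
      assume "pipe_dream_sum N w = 0"
      then have "(Var (X (Suc q)) - Var (X q)) * pipe_dream_sum N ?v = 0"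
        using swap_x_pipe_dream_sum[OF less.prems q d] by (simp add: swap_x_def)
      with \<open>pipe_dream_sum N ?v \<noteq> 0\<close> show False by simp
    qed
  qed
qed

lemma RP_nonempty: "w permutes {1..N} \<Longrightarrow> RP N w \<noteq> {}"
  using pipe_dream_sum_nonzero unfolding pipe_dream_sum_def by fastforce

section \<open>Dominant parts\<close>

definition young_shape :: "(nat \<times> nat) set \<Rightarrow> bool" where
  "young_shape S \<longleftrightarrow> (\<forall>q p q' p'. (q, p) \<in> S \<and> 1 \<le> q' \<and> q' \<le> q \<and> 1 \<le> p' \<and> p' \<le> p \<longrightarrow> (q', p') \<in> S)"

lemma pipe_straight_east:
  assumes "\<And>p'. 1 \<le> p' \<Longrightarrow> p' < p \<Longrightarrow> (q, p') \<in> D" "1 \<le> q" "1 \<le> p"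
  shows "pipe D q (q, p) West"
  using assms
proof (induction p)
  case (Suc p)
  show ?case
  proof (cases "p = 0")
    case True
    then show ?thesis using pipe.start[of D q] by simp
  next
    case False
    then have "pipe D q (q, p) West" using Suc by simp
    then show ?thesis using pipe.cross_west[of D q q p] Suc.prems False by simp
  qed
qed simp

lemma leads_straight_north:
  assumes "\<And>q'. 1 \<le> q' \<Longrightarrow> q' \<le> q \<Longrightarrow> (q', p) \<in> D"
  shows "leads D ((q, p), South) p"
  using assms
proof (induction q)
  case 0
  show ?case by (rule leads.exit)
next
  case (Suc q)
  then have "leads D ((q, p), South) p" by simp
  then show ?case using Suc.prems leads.step[of "Suc q" D p South p] by simp
qed

lemma exits_at_unique: "exits_at D a x \<Longrightarrow> exits_at D a y \<Longrightarrow> x = y"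
  using exits_at_iff_leads leads_unique by blast

lemma young_shape_subset_RP:
  assumes D: "D \<in> RP N w" and S: "young_shape S"
    and box: "\<And>q p. (q, p) \<in> S \<Longrightarrow> 1 \<le> q \<and> q \<le> N \<and> 1 \<le> p \<and> w q \<noteq> p"
  shows "S \<subseteq> D"
proof -
  have "(q, p) \<in> S \<Longrightarrow> (q, p) \<in> D" for q p
  proof (induction "q + p" arbitrary: q p rule: less_induct)
    case less
    have qp: "1 \<le> q" "q \<le> N" "1 \<le> p" "w q \<noteq> p" using box[OF less.prems] by auto
    have IH: "(q', p') \<in> D" if "1 \<le> q'" "q' \<le> q" "1 \<le> p'" "p' \<le> p" "q' + p' < q + p" for q' p'
      using S less that unfolding young_shape_def by blast
    show ?case
    proof (rule ccontr)
      assume nD: "(q, p) \<notin> D"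
      have "pipe D q (q, p) West"
        using IH qp by (intro pipe_straight_east) auto
      then have "pipe D q (q - 1, p) South"
        using nD qp by (intro pipe.elbow_west) auto
      moreover have "leads D ((q - 1, p), South) p"
        using IH qp by (intro leads_straight_north) auto
      ultimately have "exits_at D q p" using pipe_leads_exit by blast
      moreover have "exits_at D q (w q)" using D qp by (auto simp: RP_def)
      ultimately show False using exits_at_unique qp(4) by blast
    qed
  qed
  then show ?thesis by auto
qed

text \<open>
  Every crossing of a reduced pipe dream is between pipes \<open>a < b\<close> with \<open>w a > w b\<close>; if the box
  \<open>(a, w b)\<close> lies in the Young shape, these pipes already cross there.
\<close>

lemma RP_subset_young_shape:
  assumes D: "D \<in> RP N w" and w: "w permutes {1..N}" and S: "young_shape S" "S \<subseteq> D"
    and inv: "\<And>a b. 1 \<le> a \<Longrightarrow> a < b \<Longrightarrow> b \<le> N \<Longrightarrow> w b < w a \<Longrightarrow> (a, w b) \<in> S"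
  shows "D \<subseteq> S"
proof
  fix c assume c: "c \<in> D"
  let ?L = "stair_boxes N N"
  have pd: "pipe_dream N D" and red: "reduced_pipe_dream N D"
    using D by (auto simp: RP_def reduced_pipe_dream_def)
  have wp: "word_perm D ?L = w" and rw: "reduced_word D ?L"
    using D unfolding RP_eq_subwords[OF w] by auto
  have "c \<in> set ?L" using c pd pipe_dream_subset by blast
  then obtain L1 L2 where L: "?L = L1 @ c # L2" by (meson split_list)
  define x where "x = word_perm D L1 (box_pos c)"
  define y where "y = word_perm D L1 (Suc (box_pos c))"
  have xy: "x < y" using rw L c unfolding reduced_word_def x_def y_def by blast
  have csw: "c \<in> swaps D ?L x y"
    unfolding swaps_def x_def y_def using c L by blast
  have fin: "finite (swaps D ?L x y)" by (rule finite_subset[OF swaps_subset]) simp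
  have "card (swaps D ?L x y) \<le> 1"
    using rw xy reduced_word_iff_swaps[OF distinct_stair_boxes] by blast
  moreover have "card (swaps D ?L x y) \<noteq> 0" using csw fin by auto
  ultimately have one: "card (swaps D ?L x y) = 1" by linarith
  define a where "a = inv_into UNIV w y"
  define b where "b = inv_into UNIV w x"
  have wab: "w a = y" "w b = x"
    unfolding a_def b_def using permutes_inverses(1)[OF w] by auto
  \<comment> \<open>Exactly one exchange is an odd number, so the labels \<open>x < y\<close> finish
    in reversed order.\<close>
  have "\<not> b < a"
    using even_swaps_iff[OF distinct_stair_boxes xy, of D N N] one unfolding wp a_def b_def by simp
  moreover have "a \<noteq> b" using wab xy by auto
  ultimately have ab: "a < b" by simp
  have "x \<in> {1..N}" "y \<in> {1..N}" using swaps_labels_in_range[OF pd csw] by auto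
  then have range: "a \<in> {1..N}" "b \<in> {1..N}"
    using wab permutes_in_image[OF w] by metis+
  have aS: "(a, x) \<in> S" using inv[of a b] ab range wab xy by simp
  have x1: "1 \<le> x" using \<open>x \<in> {1..N}\<close> by simp
  have sub: "(a', x') \<in> D" if "1 \<le> a'" "a' \<le> a" "1 \<le> x'" "x' \<le> x" for a' x'
    using S aS that unfolding young_shape_def by blast
  have "pipe D a (a, x) West"
    using sub range x1 by (intro pipe_straight_east) auto
  moreover have "exits_at D b x" using D range wab by (auto simp: RP_def)
  then have "pipe D b (a, x) South"
    using leads_imp_pipe[of D "((a, x), South)" x b] leads_straight_north[of a x D] sub x1 by simp
  ultimately have "(a, x) \<in> crossings D a b"
    using aS S(2) by (auto simp: crossings_def)
  moreover have "crossings D a b = swaps D ?L y x"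
    using crossings_eq_swaps[OF pd range wp[symmetric]] wab by simp
  moreover have "swaps D ?L y x = swaps D ?L x y"
    unfolding swaps_def by (simp add: insert_commute)
  ultimately have "(a, x) \<in> swaps D ?L x y" by simp
  \<comment> \<open>Both boxes are exchanges of the same pair, of which there is only one.\<close>
  then have "c = (a, x)" using one csw by (auto simp: card_1_singleton_iff)
  then show "c \<in> S" using aS by simp
qed

lemma RP_eq_singleton:
  assumes w: "w permutes {1..N}" and S: "young_shape S"
    and box: "\<And>q p. (q, p) \<in> S \<Longrightarrow> 1 \<le> q \<and> q \<le> N \<and> 1 \<le> p \<and> w q \<noteq> p"
    and inv: "\<And>a b. 1 \<le> a \<Longrightarrow> a < b \<Longrightarrow> b \<le> N \<Longrightarrow> w b < w a \<Longrightarrow> (a, w b) \<in> S"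
  shows "RP N w = {S}"
proof -
  have "D = S" if "D \<in> RP N w" for D
    using young_shape_subset_RP[OF that S box] RP_subset_young_shape[OF that w S _ inv] by blast
  then show ?thesis using RP_nonempty[OF w] by blast
qed

section \<open>The Schubert recursion for pipe dream sums\<close>

lemma RP_longest:
  "RP N (longest_perm N) = {{(i, j). 1 \<le> i \<and> 1 \<le> j \<and> i + j \<le> N}}"
  \<comment> \<open>Column w(b) = N + 1 - b meets row a inside the staircase exactly when a < b, so
    the shape contains the box of every inversion.\<close>
  by (rule RP_eq_singleton)
    (auto simp: young_shape_def longest_perm_def intro: longest_perm_permutes[simplified])

text \<open>Whatever ascents a derivation chooses, it yields the same polynomial; this is the
  uniqueness behind \<open>THE\<close> in \<open>double_schubert\<close>.\<close>

lemma is_double_schubert_imp: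
  "is_double_schubert N w P \<Longrightarrow> w permutes {1..N} \<and> P = pipe_dream_sum N w"
proof (induction rule: is_double_schubert.induct)
  case longest
  show ?case
    by (rule conjI[OF longest_perm_permutes]) (simp add: pipe_dream_sum_def RP_longest)
next
  case (ascent w q P)
  let ?v = "w \<circ> transpose q (Suc q)"
  have v: "?v permutes {1..N}" and P: "P = pipe_dream_sum N ?v" 
    using ascent.IH unfolding Suc_eq_plus1 by blast+
  have "?v (Suc q) < ?v q" using ascent.hyps by simp
  from divided_difference_pipe_dream_sum[OF v ascent.hyps(2,3) this]
  have "divided_difference q P = pipe_dream_sum N w"
    unfolding P comp_assoc transpose_comp_involutory comp_id .
  with ascent.hyps(1) show ?case by simp
qed

lemma is_double_schubert_exists:
  assumes "w permutes {1..N}"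
  shows "\<exists>P. is_double_schubert N w P"
  using assms
proof (induction "\<Sum>i\<in>{1..N}. i * w i" arbitrary: w rule: less_induct)
  case less
  show ?case
  proof (cases "\<exists>q. 1 \<le> q \<and> q < N \<and> w q < w (Suc q)")
    case False
    then have "w = longest_perm N"
      using permutes_descending_imp_longest[OF less.prems] by (meson not_le_imp_less)
    then show ?thesis using is_double_schubert.longest by blast
  next
    case True
    then obtain q where q: "1 \<le> q" "q < N" and a: "w q < w (Suc q)" by blast
    let ?v = "w \<circ> transpose q (Suc q)"
    have v: "?v permutes {1..N}"
      using less.prems q by (intro permutes_compose permutes_swap_id) auto
    have "(\<Sum>i\<in>{1..N}. i * ?v i) < (\<Sum>i\<in>{1..N}. i * w i)"
      using weighted_sum_transpose[OF q, of w] a by linarith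
    then obtain P where "is_double_schubert N ?v P" using less.hyps v by blast
    then show ?thesis
      using is_double_schubert.ascent[of w N q P] less.prems q a by auto
  qed
qed

lemma double_schubert_eq_pipe_dream_sum:
  assumes "w permutes {1..N}"
  shows "double_schubert N w = pipe_dream_sum N w"
proof -
  obtain P where P: "is_double_schubert N w P" using is_double_schubert_exists[OF assms] by blast
  then have "double_schubert N w = P"
    unfolding double_schubert_def using is_double_schubert_imp by (intro the_equality) blast+
  then show ?thesis using is_double_schubert_imp[OF P] by simp
qed

section \<open>Blocks\<close>

text \<open>Block columns are labelled \<open>n\<close>, ..., \<open>0\<close>, so for
  \<open>f = e\<close> this is the total width to the left of block column \<open>i\<close>. With
  block counts for \<open>f\<close> it gives offsets inside a block row.\<close>

definition tail_sum :: "nat \<Rightarrow> (nat \<Rightarrow> nat) \<Rightarrow> nat \<Rightarrow> nat" where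
  "tail_sum n f i = (\<Sum>l\<in>{i<..n}. f l)"

lemma tail_sum_n [simp]: "tail_sum n f n = 0"
  by (simp add: tail_sum_def)

lemma tail_sum_Suc: "i < n \<Longrightarrow> tail_sum n f i = tail_sum n f (Suc i) + f (Suc i)"
proof -
  assume "i < n"
  then have "{i<..n} = insert (Suc i) {Suc i<..n}" by auto
  then show ?thesis by (simp add: tail_sum_def)
qed

lemma tail_sum_0: "tail_sum n f 0 + f 0 = (\<Sum>l\<le>n. f l)"
proof -
  have "{..n} = insert 0 {0<..n}" by auto
  then show ?thesis by (simp add: tail_sum_def)
qed

lemma tail_sum_less: "i < i' \<Longrightarrow> i' \<le> n \<Longrightarrow> tail_sum n f i' + f i' \<le> tail_sum n f i"
proof (induction i')
  case (Suc k)
  then show ?case using tail_sum_Suc[of k n f] by (cases "i = k") auto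
qed simp

lemma tail_sum_le_total: "i \<le> n \<Longrightarrow> tail_sum n f i + f i \<le> (\<Sum>l\<le>n. f l)"
  using tail_sum_0[of n f] tail_sum_less[of 0 i n f] by (cases "i = 0") auto

lemma tail_sum_interval:
  assumes "0 < x" "x \<le> (\<Sum>l\<le>n. f l)"
  obtains i where "i \<le> n" "tail_sum n f i < x" "x \<le> tail_sum n f i + f i"
proof -
  let ?P = "\<lambda>i. i \<le> n \<and> x \<le> tail_sum n f i + f i"
  have P0: "?P 0" using assms tail_sum_0[of n f] by simp
  \<comment> \<open>The intervals move to the left as \<open>i\<close> grows; failure at
    \<open>Suc i\<close> says that \<open>x\<close> lies beyond
    \<open>tail_sum n f i\<close>.\<close>
  define i where "i = (GREATEST i. ?P i)"
  have i: "?P i" unfolding i_def by (rule GreatestI_nat[of ?P, OF P0]) auto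
  have "tail_sum n f i < x"
  proof (cases "i = n")
    case True
    then show ?thesis using assms by simp
  next
    case False
    then have less: "i < n" using i by simp
    have "\<not> ?P (Suc i)"
    proof
      assume "?P (Suc i)"
      then have "Suc i \<le> i" unfolding i_def by (rule Greatest_le_nat) auto
      then show False by simp
    qed
    then show ?thesis using less tail_sum_Suc[OF less, of f] by simp
  qed
  with i that show thesis by blast
qed

definition head_sum :: "(nat \<Rightarrow> nat) \<Rightarrow> nat \<Rightarrow> nat" where
  "head_sum f j = (\<Sum>l<j. f l)"

lemma head_sum_Suc [simp]: "head_sum f (Suc j) = head_sum f j + f j"
  by (simp add: head_sum_def)

lemma head_sum_0 [simp]: "head_sum f 0 = 0"
  by (simp add: head_sum_def)

lemma head_sum_less: "j < j' \<Longrightarrow> head_sum f j + f j \<le> head_sum f j'"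
proof (induction j')
  case (Suc k)
  then show ?case by (cases "j = k") auto
qed simp

lemma block_col_iff: "p \<in> block_col n e i \<longleftrightarrow> tail_sum n e i < p \<and> p \<le> tail_sum n e i + e i"
  by (simp add: block_col_def tail_sum_def)

lemma block_row_iff: "q \<in> block_row e j \<longleftrightarrow> head_sum e j < q \<and> q \<le> head_sum e j + e j"
  by (simp add: block_row_def head_sum_def)

lemma total_dim_eq_head_sum: "total_dim n e = head_sum e (Suc n)"
  by (simp add: total_dim_def head_sum_def lessThan_Suc_atMost)

lemma block_row_subset: "j \<le> n \<Longrightarrow> block_row e j \<subseteq> {1..total_dim n e}"
  using head_sum_less[of j "Suc n" e] unfolding total_dim_eq_head_sum by (auto simp: block_row_iff simp del: head_sum_Suc)

lemma block_col_subset: "i \<le> n \<Longrightarrow> block_col n e i \<subseteq> {1..total_dim n e}"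
  using tail_sum_le_total[of i n e] by (auto simp: block_col_iff total_dim_def)

lemma block_row_exists:
  assumes "q \<in> {1..total_dim n e}"
  obtains j where "j \<le> n" "q \<in> block_row e j"
proof -
  have "1 \<le> q \<Longrightarrow> q \<le> head_sum e (Suc m) \<Longrightarrow> \<exists>j\<le>m. q \<in> block_row e j" for m
  proof (induction m)
    case 0
    then show ?case by (auto simp: block_row_iff)
  next
    case (Suc m)
    show ?case
    proof (cases "q \<le> head_sum e (Suc m)")
      case True
      then show ?thesis using Suc le_SucI by blast
    next
      case False
      then have "q \<in> block_row e (Suc m)" using Suc.prems by (simp add: block_row_iff)
      then show ?thesis by blast
    qed
  qed
  then show thesis using assms that unfolding total_dim_eq_head_sum by (auto simp del: head_sum_Suc)
qed

lemma block_row_less: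
  "q \<in> block_row e j \<Longrightarrow> q' \<in> block_row e j' \<Longrightarrow> j < j' \<Longrightarrow> q < q'"
  using head_sum_less[of j j' e] by (auto simp: block_row_iff)

lemma block_row_unique:
  "q \<in> block_row e j \<Longrightarrow> q \<in> block_row e j' \<Longrightarrow> j = j'"
  using block_row_less[of q e j q j'] block_row_less[of q e j' q j]
  by (cases j j' rule: linorder_cases) auto

lemma block_col_exists:
  assumes "p \<in> {1..total_dim n e}"
  obtains i where "i \<le> n" "p \<in> block_col n e i"
  using tail_sum_interval[of p e n] assms by (auto simp: block_col_iff total_dim_def)

lemma block_col_less:
  "p \<in> block_col n e i \<Longrightarrow> p' \<in> block_col n e i' \<Longrightarrow> i' < i \<Longrightarrow> i \<le> n \<Longrightarrow> p < p'"
  using tail_sum_less[of i' i n e] by (auto simp: block_col_iff)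

lemma block_col_unique:
  "p \<in> block_col n e i \<Longrightarrow> p \<in> block_col n e i' \<Longrightarrow> i \<le> n \<Longrightarrow> i' \<le> n \<Longrightarrow> i = i'"
  using block_col_less[of p n e i p i'] block_col_less[of p n e i' p i]
  by (cases i i' rule: linorder_cases) auto

section \<open>Block permutations with prescribed block counts\<close>

definition block_sorted :: "nat \<Rightarrow> (nat \<Rightarrow> nat) \<Rightarrow> (nat \<Rightarrow> nat \<Rightarrow> nat) \<Rightarrow> (nat \<Rightarrow> nat) \<Rightarrow> bool" where
  "block_sorted n e c v \<longleftrightarrow>
     v permutes {1..total_dim n e} \<and>
     (\<forall>i\<le>n. \<forall>j\<le>n. ones_in_block n e v i j = c i j) \<and>
     (\<forall>j\<le>n. \<forall>q\<in>block_row e j. \<forall>q'\<in>block_row e j. q < q' \<longrightarrow> v q < v q') \<and>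
     (\<forall>i\<le>n. \<forall>q q'. v q \<in> block_col n e i \<and> v q' \<in> block_col n e i \<and> v q < v q' \<longrightarrow> q < q')"

text \<open>
  The rows of block row \<open>j\<close> whose ones lie in block column \<open>i\<close> form an interval determined
  by the block counts.
\<close>

definition cell :: "nat \<Rightarrow> (nat \<Rightarrow> nat) \<Rightarrow> (nat \<Rightarrow> nat \<Rightarrow> nat) \<Rightarrow> nat \<Rightarrow> nat \<Rightarrow> nat set" where
  "cell n e c i j = {head_sum e j + tail_sum n (\<lambda>l. c l j) i <..
     head_sum e j + tail_sum n (\<lambda>l. c l j) i + c i j}"

definition col_cells :: "nat \<Rightarrow> (nat \<Rightarrow> nat) \<Rightarrow> (nat \<Rightarrow> nat \<Rightarrow> nat) \<Rightarrow> nat \<Rightarrow> nat set" where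
  "col_cells n e c i = (\<Union>j\<le>n. cell n e c i j)"

lemma card_cell: "card (cell n e c i j) = c i j"
  by (simp add: cell_def)

context
  fixes n :: nat and e :: "nat \<Rightarrow> nat" and c :: "nat \<Rightarrow> nat \<Rightarrow> nat"
  assumes row_sum: "\<And>j. j \<le> n \<Longrightarrow> (\<Sum>i\<le>n. c i j) = e j"
    and col_sum: "\<And>i. i \<le> n \<Longrightarrow> (\<Sum>j\<le>n. c i j) = e i"
begin

lemma cell_subset_row: "i \<le> n \<Longrightarrow> j \<le> n \<Longrightarrow> cell n e c i j \<subseteq> block_row e j"
  using tail_sum_le_total[of i n "\<lambda>l. c l j"] row_sum[of j]
  by (auto simp: cell_def block_row_iff)

lemma cell_exists:
  assumes "j \<le> n" "q \<in> block_row e j"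
  obtains i where "i \<le> n" "q \<in> cell n e c i j"
proof -
  have "0 < q - head_sum e j" "q - head_sum e j \<le> (\<Sum>l\<le>n. c l j)"
    using assms row_sum by (auto simp: block_row_iff)
  then obtain i where "i \<le> n" "tail_sum n (\<lambda>l. c l j) i < q - head_sum e j"
    "q - head_sum e j \<le> tail_sum n (\<lambda>l. c l j) i + c i j"
    by (rule tail_sum_interval)
  then have "q \<in> cell n e c i j" by (auto simp: cell_def)
  with \<open>i \<le> n\<close> show thesis by (rule that)
qed

lemma cell_less:
  "q \<in> cell n e c i j \<Longrightarrow> q' \<in> cell n e c i' j \<Longrightarrow> i' < i \<Longrightarrow> i \<le> n \<Longrightarrow> q < q'"
  using tail_sum_less[of i' i n "\<lambda>l. c l j"] by (auto simp: cell_def)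

lemma cell_unique:
  assumes "q \<in> cell n e c i j" "q \<in> cell n e c i' j" "i \<le> n" "i' \<le> n"
  shows "i = i'"
  using cell_less[OF assms(1,2)] cell_less[OF assms(2,1)] assms
  by (cases i i' rule: linorder_cases) auto

lemma col_cells_exists:
  assumes "q \<in> {1..total_dim n e}"
  obtains i where "i \<le> n" "q \<in> col_cells n e c i"
proof -
  obtain j where "j \<le> n" "q \<in> block_row e j" using assms by (rule block_row_exists)
  moreover from this obtain i where "i \<le> n" "q \<in> cell n e c i j" by (rule cell_exists)
  ultimately show thesis using that by (auto simp: col_cells_def)
qed

lemma cell_if_col_cells:
  assumes "q \<in> col_cells n e c i" "i \<le> n" "j \<le> n" "q \<in> block_row e j"
  shows "q \<in> cell n e c i j"
proof -
  obtain j' where j': "j' \<le> n" "q \<in> cell n e c i j'" using assms(1) by (auto simp: col_cells_def)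
  then have "q \<in> block_row e j'" using cell_subset_row assms(2) by blast
  then have "j' = j" using block_row_unique assms(4) by blast
  with j' show ?thesis by simp
qed

lemma col_cells_subset: "i \<le> n \<Longrightarrow> col_cells n e c i \<subseteq> {1..total_dim n e}"
  unfolding col_cells_def using cell_subset_row block_row_subset by blast

lemma col_cells_unique:
  assumes "q \<in> col_cells n e c i" "q \<in> col_cells n e c i'" "i \<le> n" "i' \<le> n"
  shows "i = i'"
proof -
  obtain j where j: "j \<le> n" "q \<in> cell n e c i j" using assms(1) by (auto simp: col_cells_def)
  then have "q \<in> block_row e j" using cell_subset_row assms(3) by blast
  then have "q \<in> cell n e c i' j" using cell_if_col_cells assms j by blast
  then show ?thesis using cell_unique j assms by blast
qed

lemma finite_col_cells: "finite (col_cells n e c i)"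
  by (simp add: col_cells_def cell_def)

lemma card_col_cells:
  assumes "i \<le> n"
  shows "card (col_cells n e c i) = e i"
proof -
  have "cell n e c i j \<inter> cell n e c i j' = {}" if "j \<le> n" "j' \<le> n" "j \<noteq> j'" for j j'
    using that cell_subset_row[OF assms] block_row_unique by blast
  then have "card (col_cells n e c i) = (\<Sum>j\<le>n. card (cell n e c i j))"
    unfolding col_cells_def by (intro card_UN_disjoint) (auto simp: cell_def)
  then show ?thesis using col_sum[OF assms] by (simp add: card_cell)
qed

text \<open>Since \<open>v\<close> increases along a block row, the rows with ones in block columns
  left of \<open>i\<close> come before those with ones in block column \<open>i\<close>. Counting
  the former bounds \<open>q\<close> below; counting both bounds it above.\<close>

lemma block_sorted_in_cell:
  assumes v: "block_sorted n e c v" and ij: "i \<le> n" "j \<le> n"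
    and q: "q \<in> block_row e j" "v q \<in> block_col n e i"
  shows "q \<in> cell n e c i j"
proof -
  let ?B = "\<lambda>l. {q' \<in> block_row e j. v q' \<in> block_col n e l}"
  have perm: "v permutes {1..total_dim n e}"
    and cardB: "\<And>l. l \<le> n \<Longrightarrow> card (?B l) = c l j"
    and mono: "\<And>q q'. q \<in> block_row e j \<Longrightarrow> q' \<in> block_row e j \<Longrightarrow> q < q' \<Longrightarrow> v q < v q'"
    using v ij unfolding block_sorted_def ones_in_block_def by blast+
  have finB: "finite (?B l)" for l by (simp add: block_row_def)
  have sub1: "{head_sum e j<..q} \<subseteq> (\<Union>l\<in>insert i {i<..n}. ?B l)"
  proof
    fix q' assume q': "q' \<in> {head_sum e j<..q}"
    then have row: "q' \<in> block_row e j" using q(1) by (auto simp: block_row_iff)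
    then have "q' \<in> {1..total_dim n e}" using block_row_subset ij by blast
    then have "v q' \<in> {1..total_dim n e}" by (simp only: permutes_in_image[OF perm])
    then obtain l where l: "l \<le> n" "v q' \<in> block_col n e l" by (rule block_col_exists)
    have "v q' \<le> v q"
      using q' mono[OF row q(1)] by (cases "q' = q") auto
    then have "\<not> l < i" using block_col_less[OF q(2) l(2)] ij by auto
    then have "l \<in> insert i {i<..n}" using l(1) by auto
    with l(2) row show "q' \<in> (\<Union>l\<in>insert i {i<..n}. ?B l)" by blast
  qed
  have "q - head_sum e j = card {head_sum e j<..q}" by simp
  also have "\<dots> \<le> card (\<Union>l\<in>insert i {i<..n}. ?B l)"
    by (rule card_mono[OF _ sub1]) (use finB in auto)
  also have "\<dots> \<le> (\<Sum>l\<in>insert i {i<..n}. card (?B l))"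
    by (rule card_UN_le) simp
  also have "\<dots> = c i j + tail_sum n (\<lambda>l. c l j) i"
    using cardB ij by (simp add: tail_sum_def)
  finally have upper: "q \<le> head_sum e j + tail_sum n (\<lambda>l. c l j) i + c i j" by linarith
  have sub2: "(\<Union>l\<in>{i<..n}. ?B l) \<subseteq> {head_sum e j<..<q}"
  proof
    fix q' assume "q' \<in> (\<Union>l\<in>{i<..n}. ?B l)"
    then obtain l where l: "i < l" "l \<le> n" "q' \<in> block_row e j" "v q' \<in> block_col n e l" by auto
    have "v q' < v q" using block_col_less[OF l(4) q(2)] l by blast
    then have "q' < q" using mono[OF q(1) l(3)] by (metis less_asym linorder_neqE_nat)
    then show "q' \<in> {head_sum e j<..<q}" using l(3) by (auto simp: block_row_iff)
  qed
  have "tail_sum n (\<lambda>l. c l j) i = (\<Sum>l\<in>{i<..n}. card (?B l))"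
    using cardB by (simp add: tail_sum_def)
  also have "\<dots> = card (\<Union>l\<in>{i<..n}. ?B l)"
  proof (rule card_UN_disjoint[symmetric])
    show "\<forall>l\<in>{i<..n}. \<forall>l'\<in>{i<..n}. l \<noteq> l' \<longrightarrow> ?B l \<inter> ?B l' = {}"
      using block_col_unique by fastforce
  qed (use finB in auto)
  also have "\<dots> \<le> card {head_sum e j<..<q}"
    by (rule card_mono[OF _ sub2]) simp
  finally have "tail_sum n (\<lambda>l. c l j) i \<le> q - Suc (head_sum e j)" by simp
  moreover have "head_sum e j < q" using q(1) by (simp add: block_row_iff)
  ultimately have "head_sum e j + tail_sum n (\<lambda>l. c l j) i < q" by linarith
  with upper show ?thesis by (simp add: cell_def)
qed

lemma block_sorted_col_iff:
  assumes v: "block_sorted n e c v" and "i \<le> n" "q \<in> {1..total_dim n e}"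
  shows "v q \<in> block_col n e i \<longleftrightarrow> q \<in> col_cells n e c i"
proof -
  have perm: "v permutes {1..total_dim n e}" using v by (simp add: block_sorted_def)
  obtain j where j: "j \<le> n" "q \<in> block_row e j" using assms(3) by (rule block_row_exists)
  have sub: "q \<in> col_cells n e c l" if "l \<le> n" "v q \<in> block_col n e l" for l
    using block_sorted_in_cell[OF v that(1) j that(2)] j(1) by (auto simp: col_cells_def)
  show ?thesis
  proof
    assume q: "q \<in> col_cells n e c i"
    have "v q \<in> {1..total_dim n e}" using assms(3) by (simp only: permutes_in_image[OF perm])
    then obtain l where l: "l \<le> n" "v q \<in> block_col n e l" by (rule block_col_exists)
    then have "l = i" using sub q col_cells_unique assms(2) by blast
    then show "v q \<in> block_col n e i" using l by simp
  qed (use sub assms(2) in blast)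
qed

text \<open>Block column \<open>i\<close> is filled by increasing rows, so the k-th row of
  \<open>col_cells\<close> gets its k-th column. The right-hand side depends on \<open>c\<close>
  only, which gives uniqueness.\<close>

lemma block_sorted_value:
  assumes v: "block_sorted n e c v" and i: "i \<le> n" and q: "q \<in> col_cells n e c i"
  shows "v q = tail_sum n e i + card {q' \<in> col_cells n e c i. q' \<le> q}"
proof -
  have perm: "v permutes {1..total_dim n e}"
    and mono: "\<And>q q'. v q \<in> block_col n e i \<Longrightarrow> v q' \<in> block_col n e i \<Longrightarrow> v q < v q' \<Longrightarrow> q < q'"
    using v i unfolding block_sorted_def by blast+
  have iff: "v q \<in> block_col n e i \<longleftrightarrow> q \<in> col_cells n e c i" if "q \<in> {1..total_dim n e}" for q
    using block_sorted_col_iff[OF v i that] .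
  have sub: "col_cells n e c i \<subseteq> {1..total_dim n e}" by (rule col_cells_subset[OF i])
  have vq: "v q \<in> block_col n e i" using iff q sub by blast
  have "v ` {q' \<in> col_cells n e c i. q' \<le> q} = {tail_sum n e i<..v q}"
  proof (intro subset_antisym subsetI)
    fix p assume "p \<in> v ` {q' \<in> col_cells n e c i. q' \<le> q}"
    then obtain q' where q': "q' \<in> col_cells n e c i" "q' \<le> q" "p = v q'" by blast
    then have p: "p \<in> block_col n e i" using iff sub by blast
    have "\<not> v q < p" using mono[OF vq, of q'] p q' by auto
    then show "p \<in> {tail_sum n e i<..v q}" using p by (auto simp: block_col_iff)
  next
    fix p assume p: "p \<in> {tail_sum n e i<..v q}"
    then have pc: "p \<in> block_col n e i" using vq by (auto simp: block_col_iff)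
    then have "p \<in> {1..total_dim n e}" using block_col_subset[OF i] by blast
    then have "p \<in> v ` {1..total_dim n e}" by (simp only: permutes_image[OF perm])
    then obtain q' where q': "q' \<in> {1..total_dim n e}" "p = v q'" by blast
    have "q' \<le> q"
    proof (cases "p = v q")
      case True
      then show ?thesis using q'(2) permutes_inj[OF perm] by (simp add: inj_eq)
    next
      case False
      then have "v q' < v q" using p q'(2) by auto
      then show ?thesis using mono[of q' q] pc vq q'(2) by auto
    qed
    moreover have "q' \<in> col_cells n e c i" using iff q' pc by blast
    ultimately show "p \<in> v ` {q' \<in> col_cells n e c i. q' \<le> q}" using q'(2) by blast
  qed
  moreover have "card (v ` {q' \<in> col_cells n e c i. q' \<le> q}) = card {q' \<in> col_cells n e c i. q' \<le> q}"
    by (rule card_image) (rule inj_on_subset[OF permutes_inj[OF perm]], simp)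
  ultimately have "card {q' \<in> col_cells n e c i. q' \<le> q} = v q - tail_sum n e i" by simp
  then show ?thesis using vq by (simp add: block_col_iff)
qed

lemma block_sorted_unique:
  assumes v: "block_sorted n e c v" and v': "block_sorted n e c v'"
  shows "v = v'"
proof (rule ext)
  fix q
  show "v q = v' q"
  proof (cases "q \<in> {1..total_dim n e}")
    case True
    then obtain i where "i \<le> n" "q \<in> col_cells n e c i" by (rule col_cells_exists)
    then show ?thesis using block_sorted_value[OF v] block_sorted_value[OF v'] by metis
  next
    case False
    have "v permutes {1..total_dim n e}" and "v' permutes {1..total_dim n e}"
      using v v' unfolding block_sorted_def by blast+
    from this[THEN permutes_not_in, OF False] show ?thesis by simp
  qed
qed

text \<open>The forced formula is taken as the definition. The row sums put each row into exactly
  one cell, and the column sums make the ranks in \<open>col_cells\<close> fill block column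
  \<open>i\<close> exactly.\<close>

lemma block_sorted_exists: "\<exists>v. block_sorted n e c v"
proof -
  let ?d = "total_dim n e" and ?A = "col_cells n e c"
  define rk where "rk i q = card {q' \<in> ?A i. q' \<le> q}" for i q
  define v where "v q = (if q \<in> {1..?d} then
    (let i = THE i. i \<le> n \<and> q \<in> ?A i in tail_sum n e i + rk i q) else q)" for q
  have val: "v q = tail_sum n e i + rk i q" if "i \<le> n" "q \<in> ?A i" for i q
  proof -
    have "(THE i. i \<le> n \<and> q \<in> ?A i) = i"
      using that col_cells_unique by (intro the_equality) blast+
    moreover have "q \<in> {1..?d}" using that col_cells_subset by blast
    ultimately show ?thesis by (simp add: v_def Let_def)
  qed
  have rk_less: "rk i q < rk i q'" if "q' \<in> ?A i" "q < q'" for i q q'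
    unfolding rk_def
  proof (rule psubset_card_mono)
    show "finite {a \<in> ?A i. a \<le> q'}" using finite_col_cells by simp
    show "{a \<in> ?A i. a \<le> q} \<subset> {a \<in> ?A i. a \<le> q'}"
    proof (rule psubsetI)
      show "{a \<in> ?A i. a \<le> q} \<subseteq> {a \<in> ?A i. a \<le> q'}" using that by auto
      have "q' \<in> {a \<in> ?A i. a \<le> q'}" "q' \<notin> {a \<in> ?A i. a \<le> q}" using that by auto
      then show "{a \<in> ?A i. a \<le> q} \<noteq> {a \<in> ?A i. a \<le> q'}" by blast
    qed
  qed
  have col: "v q \<in> block_col n e i" if iq: "i \<le> n" "q \<in> ?A i" for i q
  proof -
    have "rk i q \<le> card (?A i)"
      unfolding rk_def by (rule card_mono[OF finite_col_cells]) blast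
    moreover have "rk i q > 0"
      unfolding rk_def using iq finite_col_cells by (auto simp: card_gt_0_iff)
    ultimately show ?thesis
      using val[OF iq] card_col_cells[OF iq(1)] by (simp add: block_col_iff)
  qed
  have col_iff: "v q \<in> block_col n e i \<longleftrightarrow> q \<in> ?A i" if i: "i \<le> n" and q: "q \<in> {1..?d}" for i q
  proof -
    obtain i' where i': "i' \<le> n" "q \<in> ?A i'" using q by (rule col_cells_exists)
    show ?thesis
      using col[OF i'] col[OF i, of q] block_col_unique[of "v q" n e i i'] i i' by blast
  qed
  have into: "v q \<in> {1..?d}" if q: "q \<in> {1..?d}" for q
  proof -
    obtain i where "i \<le> n" "q \<in> ?A i" using q by (rule col_cells_exists)
    then show ?thesis using col block_col_subset by blast
  qed
  have inj: "inj_on v {1..?d}"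
  proof (rule inj_onI)
    fix q q' assume qq: "q \<in> {1..?d}" "q' \<in> {1..?d}" "v q = v q'"
    obtain i where i: "i \<le> n" "q \<in> ?A i" using qq(1) by (rule col_cells_exists)
    then have i': "q' \<in> ?A i" using col[OF i] col_iff[OF i(1) qq(2)] qq(3) by simp
    then have "rk i q = rk i q'" using val i qq(3) by simp
    then show "q = q'"
      using rk_less[OF i', of q] rk_less[OF i(2), of q'] by (cases q q' rule: linorder_cases) auto
  qed
  have perm: "v permutes {1..?d}"
  proof (rule bij_imp_permutes)
    show "bij_betw v {1..?d} {1..?d}"
      unfolding bij_betw_def
    proof (rule conjI[OF inj endo_inj_surj[OF _ _ inj]])
      show "v ` {1..?d} \<subseteq> {1..?d}" using into by blast
    qed simp
    show "v q = q" if "q \<notin> {1..?d}" for q unfolding v_def by (rule if_not_P[OF that])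
  qed
  have "ones_in_block n e v i j = c i j" if ij: "i \<le> n" "j \<le> n" for i j
  proof -
    have "{q \<in> block_row e j. v q \<in> block_col n e i} = cell n e c i j"
    proof (intro subset_antisym subsetI)
      fix q assume q: "q \<in> {q \<in> block_row e j. v q \<in> block_col n e i}"
      then have "q \<in> {1..?d}" using block_row_subset[OF ij(2)] by blast
      then have "q \<in> ?A i" using col_iff[OF ij(1)] q by blast
      then show "q \<in> cell n e c i j" using cell_if_col_cells ij q by blast
    next
      fix q assume q: "q \<in> cell n e c i j"
      then have "q \<in> ?A i" using ij by (auto simp: col_cells_def)
      then show "q \<in> {q \<in> block_row e j. v q \<in> block_col n e i}"
        using col ij q cell_subset_row by blast
    qed
    then show ?thesis by (simp add: ones_in_block_def card_cell)
  qed
  moreover have "v q < v q'"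
    if j: "j \<le> n" and q: "q \<in> block_row e j" "q' \<in> block_row e j" "q < q'" for j q q'
  proof -
    obtain i where i: "i \<le> n" "q \<in> cell n e c i j" using j q(1) by (rule cell_exists)
    obtain i' where i': "i' \<le> n" "q' \<in> cell n e c i' j" using j q(2) by (rule cell_exists)
    have A: "q \<in> ?A i" "q' \<in> ?A i'" using i i' j by (auto simp: col_cells_def)
    have "\<not> i < i'" using cell_less[OF i'(2) i(2)] i' q(3) by auto
    then consider "i = i'" | "i' < i" by linarith
    then show ?thesis
    proof cases
      case 1
      then show ?thesis using val i A rk_less[of q' i q] q(3) by simp
    next
      case 2
      then show ?thesis using block_col_less[OF col[OF i(1) A(1)] col[OF i'(1) A(2)]] i by blast
    qed
  qed
  moreover have "q < q'"
    if i: "i \<le> n" and q: "v q \<in> block_col n e i" "v q' \<in> block_col n e i" "v q < v q'" for i q q'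
  proof -
    have "v q \<in> {1..?d}" "v q' \<in> {1..?d}" using q block_col_subset[OF i] by blast+
    then have "q \<in> {1..?d}" "q' \<in> {1..?d}" by (simp_all only: permutes_in_image[OF perm])
    then have A: "q \<in> ?A i" "q' \<in> ?A i" using q col_iff[OF i] by blast+
    then have "rk i q < rk i q'" using q(3) val i by simp
    then show ?thesis using rk_less[OF A(1), of q'] by (cases q q' rule: linorder_cases) auto
  qed
  ultimately have "block_sorted n e c v"
    unfolding block_sorted_def using perm by blast
  then show ?thesis by blast
qed

end

section \<open>The Zelevinsky permutation\<close>

text \<open>\<open>nat\<close> is exact once the lace numbers are known to be nonnegative.\<close>

definition block_count :: "nat \<Rightarrow> (nat \<Rightarrow> nat \<Rightarrow> nat) \<Rightarrow> nat \<Rightarrow> nat \<Rightarrow> nat" where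
  "block_count n r i j =
     (if i \<le> j then nat (lace n r i j) else if i = j + 1 then r j (j + 1) else 0)"

text \<open>Lace numbers are mixed second differences, so the sum telescopes; the boundary terms
  with first index -1 are 0.\<close>

lemma sum_lace_row:
  "(\<Sum>i\<le>k. lace n r i j) = ext_rank n r (int k) (int j) - ext_rank n r (int k) (int j + 1)"
proof (induction k)
  case 0
  show ?case by (simp add: lace_def ext_rank_def)
next
  case (Suc k)
  then show ?case by (simp add: lace_def algebra_simps)
qed

lemma sum_lace_col:
  "i \<le> Suc n \<Longrightarrow> (\<Sum>j\<in>{i..n}. lace n r i j) =
    ext_rank n r (int i) (int i) - ext_rank n r (int i - 1) (int i)"
proof -
  let ?g = "\<lambda>j. ext_rank n r (int i) (int j) - ext_rank n r (int i - 1) (int j)"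
  assume "i \<le> Suc n"
  then have "(\<Sum>j\<in>{i..n}. ?g (Suc j) - ?g j) = ?g (Suc n) - ?g i"
    by (intro sum_Suc_diff) simp
  moreover have "(\<Sum>j\<in>{i..n}. ?g (Suc j) - ?g j) = - (\<Sum>j\<in>{i..n}. lace n r i j)"
    unfolding sum_negf[symmetric] by (rule sum.cong) (simp_all add: lace_def algebra_simps)
  moreover have "?g (Suc n) = 0" by (simp add: ext_rank_def)
  ultimately show ?thesis by linarith
qed

text \<open>A common interface: occurring rank arrays satisfy it by the Frobenius inequality, the
  array of minima by direct computation.\<close>

locale rank_array =
  fixes n :: nat and e :: "nat \<Rightarrow> nat" and r :: "nat \<Rightarrow> nat \<Rightarrow> nat"
  assumes diag: "\<And>i. i \<le> n \<Longrightarrow> r i i = e i"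
    and lace_nonneg: "\<And>i j. i \<le> j \<Longrightarrow> j \<le> n \<Longrightarrow> 0 \<le> lace n r i j"
begin

text \<open>The lace numbers in block row \<open>j\<close> telescope to r_jj - r_{j,j+1}, and the
  superantidiagonal block supplies r_{j,j+1}. For \<open>j = n\<close> there is no such block, in
  accordance with the default value 0 of \<open>ext_rank\<close>.\<close>

lemma block_count_row_sum:
  assumes "j \<le> n"
  shows "(\<Sum>i\<le>n. block_count n r i j) = e j"
proof -
  have "{..n} = {..j} \<union> {j<..n}" using assms by auto
  then have "(\<Sum>i\<le>n. block_count n r i j) =
    (\<Sum>i\<le>j. block_count n r i j) + (\<Sum>i\<in>{j<..n}. block_count n r i j)"
    by (simp only:) (rule sum.union_disjoint, auto)
  then have "int (\<Sum>i\<le>n. block_count n r i j) =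
    int (\<Sum>i\<le>j. block_count n r i j) + int (\<Sum>i\<in>{j<..n}. block_count n r i j)"
    by simp
  also have "int (\<Sum>i\<le>j. block_count n r i j) = (\<Sum>i\<le>j. lace n r i j)"
    unfolding of_nat_sum by (rule sum.cong) (auto simp: block_count_def lace_nonneg assms)
  also have "int (\<Sum>i\<in>{j<..n}. block_count n r i j) = ext_rank n r (int j) (int j + 1)"
  proof (cases "j = n")
    case True
    then show ?thesis by (simp add: ext_rank_def)
  next
    case False
    then have "{j<..n} = insert (Suc j) {Suc j<..n}" using assms by auto
    moreover have "(\<Sum>i\<in>{Suc j<..n}. block_count n r i j) = 0"
      by (simp add: block_count_def)
    ultimately have "(\<Sum>i\<in>{j<..n}. block_count n r i j) = r j (Suc j)"
      by (simp add: block_count_def)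
    moreover have "nat (int j + 1) = Suc j" by simp
    ultimately show ?thesis using False assms by (simp add: ext_rank_def)
  qed
  finally have "int (\<Sum>i\<le>n. block_count n r i j) = int (e j)"
    unfolding sum_lace_row using assms diag by (simp add: ext_rank_def)
  then show ?thesis by (simp only: of_nat_eq_iff)
qed

lemma block_count_col_sum:
  assumes "i \<le> n"
  shows "(\<Sum>j\<le>n. block_count n r i j) = e i"
proof -
  have "{..n} = {..<i} \<union> {i..n}" using assms by auto
  then have "(\<Sum>j\<le>n. block_count n r i j) =
    (\<Sum>j<i. block_count n r i j) + (\<Sum>j\<in>{i..n}. block_count n r i j)"
    by (simp only:) (rule sum.union_disjoint, auto)
  then have "int (\<Sum>j\<le>n. block_count n r i j) =
    int (\<Sum>j<i. block_count n r i j) + int (\<Sum>j\<in>{i..n}. block_count n r i j)"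
    by simp
  also have "int (\<Sum>j\<in>{i..n}. block_count n r i j) = (\<Sum>j\<in>{i..n}. lace n r i j)"
    unfolding of_nat_sum by (rule sum.cong) (auto simp: block_count_def lace_nonneg)
  also have "int (\<Sum>j<i. block_count n r i j) = ext_rank n r (int i - 1) (int i)"
  proof (cases i)
    case 0
    then show ?thesis by (simp add: ext_rank_def)
  next
    case (Suc k)
    have "(\<Sum>j<k. block_count n r i j) = 0"
      using Suc by (simp add: block_count_def)
    then have "(\<Sum>j<i. block_count n r i j) = r k (Suc k)"
      using Suc by (simp add: block_count_def)
    moreover have "nat (1 + int k) = Suc k" by simp
    ultimately show ?thesis using Suc assms by (simp add: ext_rank_def)
  qed
  finally have "int (\<Sum>j\<le>n. block_count n r i j) = int (e i)"
    using sum_lace_col[of i n r] assms diag by (simp add: ext_rank_def)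
  then show ?thesis by (simp only: of_nat_eq_iff)
qed

lemma is_zelevinsky_iff: "is_zelevinsky n e r v \<longleftrightarrow> block_sorted n e (block_count n r) v"
proof -
  have "((i \<le> j \<longrightarrow> int (ones_in_block n e v i j) = lace n r i j) \<and>
      (i = j + 1 \<longrightarrow> ones_in_block n e v i j = r j (j + 1)) \<and>
      (i \<ge> j + 2 \<longrightarrow> ones_in_block n e v i j = 0)) \<longleftrightarrow>
    ones_in_block n e v i j = block_count n r i j" if "i \<le> n" "j \<le> n" for i j
  proof -
    consider "i \<le> j" | "i = j + 1" | "i \<ge> j + 2" by linarith
    then show ?thesis
    proof cases
      case 1
      then show ?thesis using lace_nonneg[of i j] that by (auto simp: block_count_def)
    qed (auto simp: block_count_def)
  qed
  then show ?thesis unfolding is_zelevinsky_def block_sorted_def by (simp only: cong: all_cong)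
qed

lemma is_zelevinsky_zelevinsky: "is_zelevinsky n e r (zelevinsky n e r)"
  unfolding zelevinsky_def
proof (rule theI'[of "is_zelevinsky n e r"])
  obtain v where "block_sorted n e (block_count n r) v"
    using block_sorted_exists[OF block_count_row_sum block_count_col_sum] by blast
  then show "\<exists>!v. is_zelevinsky n e r v"
    unfolding is_zelevinsky_iff
    using block_sorted_unique[OF block_count_row_sum block_count_col_sum] by blast
qed

lemma zelevinsky_permutes: "zelevinsky n e r permutes {1..total_dim n e}"
  using is_zelevinsky_zelevinsky unfolding is_zelevinsky_def by blast

lemma zelevinsky_avoids_D_Hom:
  assumes "(q, p) \<in> D_Hom n e"
  shows "zelevinsky n e r q \<noteq> p"
proof
  assume eq: "zelevinsky n e r q = p"
  obtain i j where ij: "i \<le> n" "j \<le> n" "i \<ge> j + 2" "q \<in> block_row e j" "p \<in> block_col n e i"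
    using assms by (auto simp: D_Hom_def)
  then have "ones_in_block n e (zelevinsky n e r) i j = 0"
    using is_zelevinsky_zelevinsky unfolding is_zelevinsky_def by blast
  moreover have "finite {q \<in> block_row e j. zelevinsky n e r q \<in> block_col n e i}"
    by (simp add: block_row_def)
  ultimately have "{q \<in> block_row e j. zelevinsky n e r q \<in> block_col n e i} = {}"
    by (simp add: ones_in_block_def)
  then show False using ij eq by blast
qed

end

section \<open>The region above the block superantidiagonal as a Young shape\<close>

lemma D_Hom_range:
  "(q, p) \<in> D_Hom n e \<Longrightarrow> q \<in> {1..total_dim n e} \<and> p \<in> {1..total_dim n e}"
  unfolding D_Hom_def using block_row_subset block_col_subset by blast

text \<open>Moving north can only lower the block row \<open>j\<close>, and moving west can only
  raise the label \<open>i\<close>, so \<open>i \<ge> j + 2\<close> persists.\<close>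

lemma D_Hom_shape:
  assumes "(q, p) \<in> D_Hom n e" "1 \<le> q'" "q' \<le> q" "1 \<le> p'" "p' \<le> p"
  shows "(q', p') \<in> D_Hom n e"
proof -
  obtain i j where ij: "i \<le> n" "j \<le> n" "i \<ge> j + 2" "q \<in> block_row e j" "p \<in> block_col n e i"
    using assms(1) by (auto simp: D_Hom_def)
  have "q \<le> total_dim n e" "p \<le> total_dim n e" using D_Hom_range[OF assms(1)] by auto
  then have "q' \<in> {1..total_dim n e}" "p' \<in> {1..total_dim n e}" using assms by auto
  then obtain i' j' where ij': "i' \<le> n" "j' \<le> n" "q' \<in> block_row e j'" "p' \<in> block_col n e i'"
    by (meson block_row_exists block_col_exists)
  have "\<not> j < j'" using block_row_less[OF ij(4) ij'(3)] assms by auto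
  moreover have "\<not> i' < i" using block_col_less[OF ij(5) ij'(4)] ij assms by auto
  ultimately have "i' \<ge> j' + 2" using ij by linarith
  then show ?thesis using ij' unfolding D_Hom_def by blast
qed

section \<open>The generic rank array\<close>

abbreviation min_array :: "(nat \<Rightarrow> nat) \<Rightarrow> nat \<Rightarrow> nat \<Rightarrow> nat" where
  "min_array e \<equiv> (\<lambda>i j. Min (e ` {i..j}))"

lemma min_array_extend:
  assumes "Suc i \<le> j"
  shows "min_array e i j = min (e i) (min_array e (Suc i) j)"
    and "i \<le> j' \<Longrightarrow> Suc j' = j \<Longrightarrow> min_array e i j = min (e j) (min_array e i j')"
proof -
  have "{i..j} = insert i {Suc i..j}" using assms by auto
  then show "min_array e i j = min (e i) (min_array e (Suc i) j)"
    using assms by simp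
  assume "i \<le> j'" "Suc j' = j"
  then have "{i..j} = insert j {i..j'}" by auto
  then show "min_array e i j = min (e j) (min_array e i j')"
    using \<open>i \<le> j'\<close> by simp
qed

text \<open>
  A lace \<open>[i, j]\<close> of the generic orbit cannot be prolonged on either side.
\<close>

lemma min_array_lace:
  assumes "i \<le> j" "j \<le> n"
  shows "0 \<le> lace n (min_array e) i j"
    and "lace n (min_array e) i j \<noteq> 0 \<Longrightarrow> k \<in> {i..j} \<Longrightarrow>
      (0 < i \<longrightarrow> e (i - 1) < e k) \<and> (j < n \<longrightarrow> e (j + 1) < e k)"
proof -
  define m where "m = min_array e i j"
  define a where "a = (if 0 < i then int (min (e (i - 1)) m) else 0)"
  define b where "b = (if j < n then int (min (e (j + 1)) m) else 0)"
  have nats: "nat (int i - 1) = i - 1" "nat (int j + 1) = Suc j" by auto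
  have lo: "min_array e (i - 1) j' = min (e (i - 1)) (min_array e i j')" if "0 < i" "i \<le> j'" for j'
    using min_array_extend(1)[of "i - 1" j' e] that by simp
  have hi: "min_array e i (Suc j) = min (e (Suc j)) m"
    using min_array_extend(2)[of i "Suc j" j e] assms by (simp add: m_def)
  have "ext_rank n (min_array e) (int i) (int j) = int m"
    using assms by (simp add: ext_rank_def m_def)
  moreover have "ext_rank n (min_array e) (int i - 1) (int j) = a"
    using assms lo[of j] by (simp add: ext_rank_def a_def m_def nats)
  moreover have "ext_rank n (min_array e) (int i) (int j + 1) = b"
    using assms hi by (simp add: ext_rank_def b_def nats)
  moreover have "ext_rank n (min_array e) (int i - 1) (int j + 1) = min a b"
    using assms hi lo[of "Suc j"] by (auto simp: ext_rank_def a_def b_def nats min_def)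
  \<comment> \<open>As a + b - min a b = max a b, the lace number is m - max a b: nonnegative
    because a and b are at most m, and nonzero only if both are smaller.\<close>
  ultimately have lace: "lace n (min_array e) i j = int m - a - b + min a b"
    by (simp add: lace_def)
  have "a \<le> int m" "b \<le> int m" by (simp_all add: a_def b_def)
  then show "0 \<le> lace n (min_array e) i j" unfolding lace by simp
  assume "lace n (min_array e) i j \<noteq> 0" and k: "k \<in> {i..j}"
  then have "a < int m \<and> b < int m"
    using \<open>a \<le> int m\<close> \<open>b \<le> int m\<close> unfolding lace by linarith
  moreover have "m \<le> e k" unfolding m_def using k by (intro Min_le) auto
  ultimately show "(0 < i \<longrightarrow> e (i - 1) < e k) \<and> (j < n \<longrightarrow> e (j + 1) < e k)"
    by (auto simp: a_def b_def split: if_splits)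
qed

lemma rank_array_min_array: "rank_array n e (min_array e)"
  by standard (use min_array_lace(1) in auto)

text \<open>An inversion with its box outside \<open>D_Hom\<close> yields laces [i', j] and [i, j']
  with i' < i \<le> j + 1 and j < j', which overlap or abut. The first cannot be prolonged to j + 1,
  so e(j+1) < e(i-1); the second cannot be prolonged to i - 1, so e(i-1) < e(j+1).\<close>

lemma zelevinsky_Hom_inversion:
  assumes a: "1 \<le> a" "a < b" "b \<le> total_dim n e" and inv: "zelevinsky_Hom n e b < zelevinsky_Hom n e a"
  shows "(a, zelevinsky_Hom n e b) \<in> D_Hom n e"
proof (rule ccontr)
  interpret rank_array n e "min_array e" by (rule rank_array_min_array)
  define v where "v = zelevinsky_Hom n e"
  have z: "is_zelevinsky n e (min_array e) v"
    using is_zelevinsky_zelevinsky by (simp add: v_def zelevinsky_Hom_def)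
  have perm: "v permutes {1..total_dim n e}"
    and counts: "\<And>i j. i \<le> n \<Longrightarrow> j \<le> n \<Longrightarrow> i \<le> j \<Longrightarrow>
        int (ones_in_block n e v i j) = lace n (min_array e) i j"
    and zero: "\<And>i j. i \<le> n \<Longrightarrow> j \<le> n \<Longrightarrow> j + 2 \<le> i \<Longrightarrow> ones_in_block n e v i j = 0"
    and rows: "\<And>j q q'. j \<le> n \<Longrightarrow> q \<in> block_row e j \<Longrightarrow> q' \<in> block_row e j \<Longrightarrow> q < q' \<Longrightarrow> v q < v q'"
    and cols: "\<And>i q q'. i \<le> n \<Longrightarrow> v q \<in> block_col n e i \<Longrightarrow> v q' \<in> block_col n e i \<Longrightarrow> v q < v q' \<Longrightarrow> q < q'"
    using z unfolding is_zelevinsky_def by blast+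
  assume not: "(a, zelevinsky_Hom n e b) \<notin> D_Hom n e"
  have less: "v b < v a" using inv by (simp add: v_def)
  have ab: "a \<in> {1..total_dim n e}" "b \<in> {1..total_dim n e}" using a by auto
  then have vab: "v a \<in> {1..total_dim n e}" "v b \<in> {1..total_dim n e}"
    by (simp_all only: permutes_in_image[OF perm])
  obtain j where j: "j \<le> n" "a \<in> block_row e j" using ab(1) by (rule block_row_exists)
  obtain j' where j': "j' \<le> n" "b \<in> block_row e j'" using ab(2) by (rule block_row_exists)
  obtain i' where i': "i' \<le> n" "v a \<in> block_col n e i'" using vab(1) by (rule block_col_exists)
  obtain i where i: "i \<le> n" "v b \<in> block_col n e i" using vab(2) by (rule block_col_exists)
  have "\<not> j' < j" using block_row_less[OF j'(2) j(2)] a by auto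
  moreover have "j \<noteq> j'" using rows[OF j(1) j(2), of b] j' a less by auto
  ultimately have jj: "j < j'" by linarith
  have "\<not> i < i'" using block_col_less[OF i'(2) i(2)] i' less by auto
  moreover have "i \<noteq> i'" using cols[OF i(1) i(2), of a] i' a less by auto
  ultimately have ii: "i' < i" by linarith
  have "\<not> j + 2 \<le> i" using not i j by (auto simp: D_Hom_def v_def)
  then have ij: "i \<le> j + 1" by linarith
  have nz: "ones_in_block n e v k l \<noteq> 0" if "q \<in> block_row e l" "v q \<in> block_col n e k" for q k l
  proof -
    have "finite {q \<in> block_row e l. v q \<in> block_col n e k}" by (simp add: block_row_def)
    then show ?thesis using that by (auto simp: ones_in_block_def)
  qed
  have "lace n (min_array e) i' j \<noteq> 0"
    using counts[of i' j] nz[OF j(2) i'(2)] i'(1) j(1) ii ij by linarith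
  moreover have "i' \<le> j" "i - 1 \<in> {i'..j}" "j < n" using ii ij jj j'(1) by auto
  ultimately have "e (j + 1) < e (i - 1)"
    using min_array_lace(2)[of i' j n e "i - 1"] j(1) by blast
  have "lace n (min_array e) i j' \<noteq> 0"
    using counts[of i j'] nz[OF j'(2) i(2)] i(1) j'(1) jj ij by linarith
  moreover have "i \<le> j'" "j + 1 \<in> {i..j'}" "0 < i" using ii ij jj by auto
  ultimately have "e (i - 1) < e (j + 1)"
    using min_array_lace(2)[of i j' n e "j + 1"] j'(1) by blast
  with \<open>e (j + 1) < e (i - 1)\<close> show False by simp
qed

section \<open>The Frobenius rank inequality\<close>

context vec_space
begin

text \<open>Independent subsets of \<open>U\<close> have at most \<open>n\<close> elements, and one
  of greatest size spans \<open>U\<close>. Dimension comparison and rank-nullity on subspaces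
  require this.\<close>

lemma subspace_fin_dim:
  assumes U: "subspace class_ring U V"
  shows "vectorspace.fin_dim class_ring (vs U)"
proof -
  have sub: "U \<subseteq> carrier_vec n" using U by (simp add: subspace_def submodule_def)
  let ?P = "\<lambda>S. S \<subseteq> U \<and> lin_indpt S"
  have empty: "?P {}" by (simp add: lin_dep_def)
  have "card S < Suc n" if "?P S" for S
    using li_le_dim(2)[OF fin_dim, of S] that sub subset_trans[of S U "carrier_vec n"]
    by (simp add: dim_is_n)
  then have "\<forall>S. ?P S \<longrightarrow> card S < Suc n" by (intro allI impI)
  with empty have "\<exists>S. ?P S \<and> (\<forall>T. ?P T \<longrightarrow> card T \<le> card S)"
    by (rule ex_has_greatest_nat)
  then obtain S where S: "S \<subseteq> U" "lin_indpt S" and max: "\<forall>T. ?P T \<longrightarrow> card T \<le> card S"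
    by (elim exE conjE)
  have SV: "S \<subseteq> carrier_vec n" using S sub by blast
  have finS: "finite S" using fin_dim_li_fin[OF fin_dim S(2)] SV by simp
  have "U \<subseteq> span S"
  proof
    fix x assume x: "x \<in> U"
    show "x \<in> span S"
    proof (rule ccontr)
      assume nx: "x \<notin> span S"
      then have xS: "x \<notin> S" using in_own_span[OF SV] by blast
      have xV: "x \<in> carrier_vec n" using x sub by blast
      have "lin_indpt (S \<union> {x})"
        using lin_dep_iff_in_span[OF SV S(2) xV xS] nx by blast
      moreover have "S \<union> {x} \<subseteq> U" using S(1) x by simp
      ultimately have "card (S \<union> {x}) \<le> card S" using max by simp
      then show False using finS xS by simp
    qed
  qed
  moreover have "span S \<subseteq> U"
    using span_is_subset[OF S(1)] U by (simp add: subspace_def)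
  ultimately have "U = span S" by blast
  then show ?thesis using fin_dim_span[OF finS] SV by simp
qed

lemma dim_subspace_mono:
  assumes U: "subspace class_ring U V" and U': "subspace class_ring U' V" and "U \<subseteq> U'"
  shows "vectorspace.dim class_ring (vs U) \<le> vectorspace.dim class_ring (vs U')"
  using vectorspace.subspace_dim[OF subspace_is_vs[OF U'] nested_subspaces[OF U' U \<open>U \<subseteq> U'\<close>]
      subspace_fin_dim[OF U']] subspace_fin_dim[OF U]
  by simp

lemma subspace_col_space:
  assumes "A \<in> carrier_mat n nc"
  shows "subspace class_ring (col_space A) V"
  unfolding col_space_def using cols_dim[of A] assms by (intro span_is_subspace) auto

end

lemma submodule_kernel:
  fixes A :: "'a::field mat"
  assumes A: "A \<in> carrier_mat m n"
    and U: "subspace class_ring U (module_vec TYPE('a) n)"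
  shows "subspace class_ring {x \<in> U. A *\<^sub>v x = 0\<^sub>v m} (module_vec TYPE('a) n)"
proof -
  interpret V: vec_space "TYPE('a)" n .
  have sub: "U \<subseteq> carrier_vec n" using U by (simp add: subspace_def submodule_def)
  have "submodule class_ring {x \<in> U. A *\<^sub>v x = 0\<^sub>v m} (module_vec TYPE('a) n)"
    using U A sub unfolding subspace_def submodule_def
    by (auto simp: mult_add_distrib_mat_vec[OF A] mult_mat_vec[OF A] subset_iff)
  then show ?thesis using U by (simp add: subspace_def)
qed

text \<open>Rank-nullity for the restriction of \<open>A\<close> to the column space of
  \<open>B\<close>, whose image is the column space of \<open>A * B\<close>.\<close>

lemma rank_mult_nullity:
  fixes A B :: "'a::field mat"
  assumes A: "A \<in> carrier_mat m n" and B: "B \<in> carrier_mat n p"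
  shows "vec_space.rank m (A * B) +
    vectorspace.dim class_ring ((module_vec TYPE('a) n)\<lparr>carrier :=
      {x \<in> vec_space.col_space n B. A *\<^sub>v x = 0\<^sub>v m}\<rparr>) = vec_space.rank n B"
proof -
  interpret V: vec_space "TYPE('a)" n .
  interpret W: vec_space "TYPE('a)" m .
  let ?X = "V.col_space B"
  have subX: "subspace class_ring ?X V.V" by (rule V.subspace_col_space[OF B])
  have U: "?X \<subseteq> carrier_vec n" using subX by (simp add: subspace_def submodule_def)
  have eqX: "?X = {y \<in> carrier_vec n. \<exists>x\<in>carrier_vec p. B *\<^sub>v x = y}"
    using V.col_space_eq[OF B] B by simp
  have AB: "A * B \<in> carrier_mat m p" using A B by simp
  have eqAB: "W.col_space (A * B) = (\<lambda>x. A *\<^sub>v x) ` ?X"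
    using W.col_space_eq[OF AB] A B eqX by (auto simp: assoc_mult_mat_vec[OF A B])
  have "linear_map class_ring (V.vs ?X) W.V (\<lambda>x. A *\<^sub>v x)"
    unfolding linear_map_def mod_hom_def mod_hom_axioms_def
  proof (intro conjI)
    show "vectorspace class_ring (V.vs ?X)" by (rule V.subspace_is_vs[OF subX])
    then show "Module.module class_ring (V.vs ?X)" by (simp add: vectorspace_def)
    show "vectorspace class_ring W.V" by unfold_locales
    then show "Module.module class_ring W.V" by (simp add: vectorspace_def)
    show "(\<lambda>x. A *\<^sub>v x) \<in> LinearCombinations.module_hom class_ring (V.vs ?X) W.V"
      using A U by (auto simp: LinearCombinations.module_hom_def mult_add_distrib_mat_vec[OF A] mult_mat_vec[OF A] subset_iff)
  qed
  then interpret T: linear_map class_ring "V.vs ?X" W.V "\<lambda>x. A *\<^sub>v x" .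
  have im: "T.im = W.col_space (A * B)" unfolding T.im_def eqAB by simp
  have ker: "T.ker = {x \<in> ?X. A *\<^sub>v x = 0\<^sub>v m}" unfolding T.ker_def by simp
  have "vectorspace.fin_dim class_ring (V.vs ?X)" by (rule V.subspace_fin_dim[OF subX])
  from T.rank_nullity[OF this, unfolded im ker] show ?thesis
    unfolding W.rank_def V.rank_def V.col_space_def W.col_space_def by simp
qed

text \<open>By \<open>rank_mult_nullity\<close> the rank lost under \<open>A\<close> is the
  dimension of its kernel on a column space. The column space of \<open>B * C\<close> lies in that
  of \<open>B\<close>, so it loses no more.\<close>

lemma rank_Frobenius:
  fixes A B C :: "'a::field mat"
  assumes A: "A \<in> carrier_mat m n" and B: "B \<in> carrier_mat n p" and C: "C \<in> carrier_mat p k"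
  shows "vec_space.rank m (A * B) + vec_space.rank n (B * C) \<le>
    vec_space.rank n B + vec_space.rank m (A * B * C)"
proof -
  interpret V: vec_space "TYPE('a)" n .
  have BC: "B * C \<in> carrier_mat n k" using B C by simp
  have sub: "V.col_space (B * C) \<subseteq> V.col_space B"
    unfolding V.col_space_eq[OF BC] V.col_space_eq[OF B]
    using B C by (auto simp: assoc_mult_mat_vec[OF B C] intro!: bexI[of _ "C *\<^sub>v _"])
  have "vectorspace.dim class_ring (V.vs {x \<in> V.col_space (B * C). A *\<^sub>v x = 0\<^sub>v m}) \<le>
    vectorspace.dim class_ring (V.vs {x \<in> V.col_space B. A *\<^sub>v x = 0\<^sub>v m})"
    using sub by (intro V.dim_subspace_mono submodule_kernel[OF A] V.subspace_col_space[OF B]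
        V.subspace_col_space[OF BC]) blast
  moreover have "A * (B * C) = A * B * C" using A B C by simp
  ultimately show ?thesis
    using rank_mult_nullity[OF A B] rank_mult_nullity[OF A BC] by simp
qed

section \<open>Rank arrays of quiver representations\<close>

lemma map_chain_refl [simp]: "map_chain e \<phi> i i = 1\<^sub>m (e i)"
  by (simp add: map_chain_def)

lemma map_chain_Suc_left:
  assumes "i < j"
  shows "map_chain e \<phi> i j = \<phi> (Suc i) * map_chain e \<phi> (Suc i) j"
proof -
  have "[i + 1..<j + 1] = Suc i # [Suc i + 1..<j + 1]"
    using assms upt_conv_Cons[of "i + 1" "j + 1"] by simp
  then show ?thesis unfolding map_chain_def by (simp del: upt_Suc)
qed

context
  fixes n :: nat and e :: "nat \<Rightarrow> nat" and \<phi> :: "nat \<Rightarrow> 'k::field mat"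
  assumes Hom: "\<phi> \<in> quiver_Hom n e"
begin

lemma quiver_map_carrier: "i < n \<Longrightarrow> \<phi> (Suc i) \<in> carrier_mat (e i) (e (Suc i))"
  using Hom by (auto simp: quiver_Hom_def dest!: bspec[of _ _ "Suc i"])

lemma map_chain_carrier: "i \<le> j \<Longrightarrow> j \<le> n \<Longrightarrow> map_chain e \<phi> i j \<in> carrier_mat (e i) (e j)"
proof (induction i rule: inc_induct)
  case (step i)
  then show ?case
    using quiver_map_carrier[of i] by (auto simp: map_chain_Suc_left intro!: mult_carrier_mat)
qed simp

lemma map_chain_Suc_right:
  "i \<le> j \<Longrightarrow> j < n \<Longrightarrow> map_chain e \<phi> i (Suc j) = map_chain e \<phi> i j * \<phi> (Suc j)"
proof (induction i rule: inc_induct)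
  case base
  then show ?case
    using quiver_map_carrier[of j] by (simp add: map_chain_Suc_left)
next
  case (step i)
  then have "map_chain e \<phi> i (Suc j) = \<phi> (Suc i) * (map_chain e \<phi> (Suc i) j * \<phi> (Suc j))"
    by (simp add: map_chain_Suc_left)
  also have "\<dots> = \<phi> (Suc i) * map_chain e \<phi> (Suc i) j * \<phi> (Suc j)"
    using step quiver_map_carrier[of i] quiver_map_carrier[of j] map_chain_carrier[of "Suc i" j]
    by (intro assoc_mult_mat[symmetric]) auto
  finally show ?case using step by (simp add: map_chain_Suc_left)
qed

text \<open>On the diagonal the chain is an identity matrix of full rank, so one formula covers both
  cases of the definition.\<close>

lemma rank_array_of_eq_rank:
  "rank_array_of e \<phi> i j = vec_space.rank (e i) (map_chain e \<phi> i j)"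
proof -
  interpret vec_space "TYPE('k)" "e i" .
  have "det (1\<^sub>m (e i) :: 'k mat) \<noteq> 0" by simp
  then have "rank (1\<^sub>m (e i) :: 'k mat) = e i"
    using det_rank_iff[of "1\<^sub>m (e i)"] by simp
  then show ?thesis by (cases "i = j") (auto simp: rank_array_of_def)
qed

text \<open>
  The Frobenius inequality bounds the lace numbers away from the border; on the border one of the
  two maps is replaced by a zero map, whose products have rank \<open>0\<close>.
\<close>

lemma lace_rank_array_nonneg:
  assumes r: "\<And>i j. i \<le> j \<Longrightarrow> j \<le> n \<Longrightarrow> r i j = rank_array_of e \<phi> i j"
    and ij: "i \<le> j" "j \<le> n"
  shows "0 \<le> lace n r i j"
proof -
  let ?B = "map_chain e \<phi> i j"
  define m where "m = (if 0 < i then e (i - 1) else 0)"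
  define k where "k = (if j < n then e (Suc j) else 0)"
  define A :: "'k mat" where "A = (if 0 < i then \<phi> i else 0\<^sub>m 0 (e i))"
  define C :: "'k mat" where "C = (if j < n then \<phi> (Suc j) else 0\<^sub>m (e j) 0)"
  have B: "?B \<in> carrier_mat (e i) (e j)" using ij by (rule map_chain_carrier)
  have A: "A \<in> carrier_mat m (e i)"
    using quiver_map_carrier[of "i - 1"] ij by (cases i) (simp_all add: A_def m_def)
  have C: "C \<in> carrier_mat (e j) k"
    using quiver_map_carrier[of j] ij by (simp add: C_def k_def)
  have zero: "vec_space.rank m (0\<^sub>m m k' :: 'k mat) = 0" for m k'
    by (rule vec_space.rank_0I)
  have rk: "r i' j' = vec_space.rank (e i') (map_chain e \<phi> i' j')" if "i' \<le> j'" "j' \<le> n" for i' j'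
    using r[OF that] rank_array_of_eq_rank by simp
  have left: "map_chain e \<phi> (i - 1) j' = \<phi> i * map_chain e \<phi> i j'" if "0 < i" "i \<le> j'" for j'
    using map_chain_Suc_left[of "i - 1" j'] that by (cases i) simp_all
  have nats: "nat (int i - 1) = i - 1" "nat (int j + 1) = Suc j" by auto
  have "ext_rank n r (int i) (int j) = int (vec_space.rank (e i) ?B)"
    using ij rk[of i j] by (simp add: ext_rank_def)
  moreover have "ext_rank n r (int i - 1) (int j) \<le> int (vec_space.rank m (A * ?B))"
    using ij rk[of "i - 1" j] left[of j] by (auto simp: ext_rank_def nats A_def m_def)
  moreover have "ext_rank n r (int i) (int j + 1) \<le> int (vec_space.rank (e i) (?B * C))"
    using ij rk[of i "Suc j"] map_chain_Suc_right[of i j]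
    by (auto simp: ext_rank_def nats C_def k_def)
  moreover have "int (vec_space.rank m (A * ?B * C)) = ext_rank n r (int i - 1) (int j + 1)"
  proof (cases "0 < i \<and> j < n")
    case True
    then have "A * ?B * C = map_chain e \<phi> (i - 1) (Suc j)"
      using ij left[of j] map_chain_Suc_right[of "i - 1" j] by (simp add: A_def C_def)
    then show ?thesis using True ij rk[of "i - 1" "Suc j"] by (simp add: ext_rank_def nats m_def)
  next
    case False
    have carrier: "A * ?B * C \<in> carrier_mat m k" using A B C by simp
    \<comment> \<open>On the border the triple product has no rows or no columns, so it is a zero
      matrix, matching the default value of \<open>ext_rank\<close>.\<close>
    have "m = 0 \<or> k = 0" using False by (auto simp: m_def k_def)
    then have "A * ?B * C = 0\<^sub>m m k" using carrier by (intro eq_matI) auto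
    then show ?thesis using False ij by (auto simp: zero ext_rank_def)
  qed
  ultimately show ?thesis
    using rank_Frobenius[OF A B C] by (simp add: lace_def)
qed

end

lemma can_occur_imp_rank_array:
  assumes "can_occur TYPE('k::field) n e r"
  shows "rank_array n e r"
proof -
  obtain \<phi> :: "nat \<Rightarrow> 'k mat" where \<phi>: "\<phi> \<in> quiver_Hom n e"
    and r: "\<And>i j. i \<le> j \<Longrightarrow> j \<le> n \<Longrightarrow> r i j = rank_array_of e \<phi> i j"
    using assms by (auto simp: can_occur_def)
  show ?thesis
    by standard (use r lace_rank_array_nonneg[OF \<phi> r] in \<open>auto simp: rank_array_of_def\<close>)
qed

section \<open>The pipe dream formula\<close>

lemma length_row_labels: "length (row_labels n e) = total_dim n e"
  by (simp add: row_labels_def total_dim_def length_concat o_def interv_sum_list_conv_sum_set_nat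
      atLeast0LessThan lessThan_Suc_atMost del: upt_Suc)

lemma length_col_labels: "length (col_labels n e) = total_dim n e"
  by (simp add: col_labels_def total_dim_def length_concat o_def rev_map[symmetric]
      interv_sum_list_conv_sum_set_nat atLeast0LessThan lessThan_Suc_atMost del: upt_Suc)

lemma row_var_neq_col_var:
  assumes "q \<in> {1..total_dim n e}" "p \<in> {1..total_dim n e}"
  shows "row_var n e q \<noteq> col_var n e p"
proof -
  have "row_labels n e ! (q - 1) \<in> set (row_labels n e)"
    using assms by (intro nth_mem) (auto simp: length_row_labels)
  then have "row_labels n e ! (q - 1) \<in> range X" by (auto simp: row_labels_def)
  moreover have "col_labels n e ! (p - 1) \<in> set (col_labels n e)"
    using assms by (intro nth_mem) (auto simp: length_col_labels)
  then have "col_labels n e ! (p - 1) \<in> range Y" by (auto simp: col_labels_def)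
  ultimately show ?thesis by (auto simp: row_var_def col_var_def)
qed

lemma quiver_schubert_eq:
  assumes "w permutes {1..total_dim n e}"
  shows "quiver_schubert n e w = (\<Sum>D\<in>RP (total_dim n e) w. box_monomial n e D)"
  unfolding quiver_schubert_def double_schubert_eq_pipe_dream_sum[OF assms] pipe_dream_sum_def
    poly_subst_sum poly_subst_prod box_monomial_def
  by (intro sum.cong prod.cong) (auto simp: poly_subst_diff)

lemma young_shape_D_Hom: "young_shape (D_Hom n e)"
  unfolding young_shape_def using D_Hom_shape by blast

lemma (in rank_array) D_Hom_subset_RP:
  assumes "D \<in> RP (total_dim n e) (zelevinsky n e r)"
  shows "D_Hom n e \<subseteq> D"
proof (rule young_shape_subset_RP[OF assms young_shape_D_Hom])
  fix q p assume qp: "(q, p) \<in> D_Hom n e"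
  show "1 \<le> q \<and> q \<le> total_dim n e \<and> 1 \<le> p \<and> zelevinsky n e r q \<noteq> p"
    using D_Hom_range[OF qp] zelevinsky_avoids_D_Hom[OF qp] by simp
qed

lemma RP_zelevinsky_Hom: "RP (total_dim n e) (zelevinsky_Hom n e) = {D_Hom n e}"
proof -
  interpret rank_array n e "min_array e" by (rule rank_array_min_array)
  have perm: "zelevinsky_Hom n e permutes {1..total_dim n e}"
    unfolding zelevinsky_Hom_def by (rule zelevinsky_permutes)
  show ?thesis
  proof (rule RP_eq_singleton[OF perm young_shape_D_Hom])
    fix q p assume qp: "(q, p) \<in> D_Hom n e"
    show "1 \<le> q \<and> q \<le> total_dim n e \<and> 1 \<le> p \<and> zelevinsky_Hom n e q \<noteq> p"
      using D_Hom_range[OF qp] zelevinsky_avoids_D_Hom[OF qp] by (simp add: zelevinsky_Hom_def)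
  qed (rule zelevinsky_Hom_inversion)
qed

text \<open>In an integral domain it suffices that each factor is a difference of distinct
  variables, an \<open>X\<close> and a \<open>Y\<close>. Thus the denominator of the quiver
  polynomial is nonzero.\<close>

lemma box_monomial_D_Hom_nonzero: "box_monomial n e (D_Hom n e) \<noteq> 0"
proof -
  have "D_Hom n e \<subseteq> {1..total_dim n e} \<times> {1..total_dim n e}"
    using D_Hom_range by auto
  then have "finite (D_Hom n e)" by (rule finite_subset) simp
  moreover have "row_var n e q - col_var n e p \<noteq> 0" if "(q, p) \<in> D_Hom n e" for q p
    using row_var_neq_col_var D_Hom_range[OF that] by simp
  ultimately show ?thesis
    unfolding box_monomial_def by auto
qed

theorem theorem5:
  fixes n :: nat and e :: "nat \<Rightarrow> nat" and r :: "nat \<Rightarrow> nat \<Rightarrow> nat"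
  assumes "n \<ge> 1"
    and "can_occur TYPE('k::field) n e r"
  shows "double_quiver_poly n e r =
    Fraction_Field.Fract
      (\<Sum>D\<in>RP (total_dim n e) (zelevinsky n e r). box_monomial n e (D - D_Hom n e)) 1"
proof -
  interpret rank_array n e r using assms(2) by (rule can_occur_imp_rank_array)
  interpret Hom: rank_array n e "min_array e" by (rule rank_array_min_array)
  let ?d = "total_dim n e" and ?v = "zelevinsky n e r"
  let ?m = "box_monomial n e (D_Hom n e)"
  let ?S = "\<Sum>D\<in>RP ?d ?v. box_monomial n e (D - D_Hom n e)"
  have "box_monomial n e D = ?m * box_monomial n e (D - D_Hom n e)" if D: "D \<in> RP ?d ?v" for D
  proof -
    have "D \<subseteq> {(q, p). 1 \<le> q \<and> 1 \<le> p \<and> q + p \<le> ?d}"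
      using D by (auto simp: RP_def reduced_pipe_dream_def pipe_dream_def)
    also have "\<dots> \<subseteq> {..?d} \<times> {..?d}" by auto
    finally have "finite D" by (rule finite_subset) simp
    then show ?thesis
      unfolding box_monomial_def using prod.subset_diff[OF D_Hom_subset_RP[OF D]]
      by (metis mult.commute)
  qed
  then have "quiver_schubert n e ?v = ?m * ?S"
    by (simp add: quiver_schubert_eq[OF zelevinsky_permutes] sum_distrib_left)
  moreover have "quiver_schubert n e (zelevinsky_Hom n e) = ?m"
    using quiver_schubert_eq[OF Hom.zelevinsky_permutes] RP_zelevinsky_Hom
    by (simp add: zelevinsky_Hom_def)
  \<comment> \<open>Numerator and denominator share the nonzero factor \<open>?m\<close>, which
    cancels in the field of fractions.\<close>
  ultimately show ?thesis
    using box_monomial_D_Hom_nonzero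
    by (simp add: double_quiver_poly_def eq_fract mult.commute)
qed

end
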